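(* For any $0<r<\frac12\log 2$, $$\mu(K_r)=\frac{4r^2\log(1/r)}{\zeta(2)}+O(r^2),$$ where $\zeta(2)=\pi^2/6$ and the implied constant is absolute.
   Context: $X=\mathrm{SL}_2(\mathbb{R})/\mathrm{SL}_2(\mathbb{Z})$ is the space of unimodular lattices in $\mathbb{R}^2$, and $\mu$ is the $\mathrm{SL}_2(\mathbb{R})$-invariant probability measure on $X$. $\|\cdot\|$ denotes the supremum norm on $\mathbb{R}^2$. For $\Lambda\in X$ let $\Delta(\Lambda)=\sup_{v\in\Lambda\smallsetminus\{0\}}\log(1/\|v\|)$, and for $r\ge0$ let $K_r=\Delta^{-1}([0,r])$, the set of lattices all of whose nonzero vectors have supremum norm at least $e^{-r}$. *)

theory Defs
  imports "HOL-Probability.Probability"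
begin

definition supnorm :: "real^2 \<Rightarrow> real" where
  "supnorm v = max \<bar>v$1\<bar> \<bar>v$2\<bar>"

definition SL2 :: "(real^2^2) set" where
  "SL2 = {g. det g = 1}"

definition lat :: "real^2^2 \<Rightarrow> (real^2) set" where
  "lat g = {g *v z | z. \<forall>i. z$i \<in> \<int>}"

text \<open>X = SL_2(R)/SL_2(Z), realised as the set of unimodular lattices.\<close>
definition unimod_lattices :: "(real^2) set set" where
  "unimod_lattices = lat ` SL2"

definition act :: "real^2^2 \<Rightarrow> (real^2) set \<Rightarrow> (real^2) set" where
  "act g L = (\<lambda>v. g *v v) ` L"

definition Delta :: "(real^2) set \<Rightarrow> real" where
  "Delta L = (SUP v\<in>L - {0}. ln (1 / supnorm v))"

definition K :: "real \<Rightarrow> (real^2) set set" where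
  "K r = {L \<in> unimod_lattices. Delta L \<in> {0..r}}"

text \<open>Borel sets of X = quotient sigma-algebra of the Borel sets of SL_2(R).\<close>
definition lattice_sets :: "(real^2) set set set" where
  "lattice_sets = {A. A \<subseteq> unimod_lattices \<and> {g \<in> SL2. lat g \<in> A} \<in> sets borel}"

definition invariant_prob :: "(real^2) set measure \<Rightarrow> bool" where
  "invariant_prob M \<longleftrightarrow> prob_space M \<and> space M = unimod_lattices \<and> sets M = lattice_sets \<and>
     (\<forall>g\<in>SL2. \<forall>A\<in>sets M. emeasure M (act g ` A) = emeasure M A)"

end

theory Submission
  imports Defs
begin

text \<open>
  Lift an invariant probability measure \<open>M\<close> on the space of lattices to \<open>SL\<^sub>2(\<real>)\<close> by counting bases.
  The lift is left invariant, so it is proportional to Haar measure \<open>dx dy dq / \<bar>y\<bar>\<close>, where \<open>(x, y)\<close> and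
  \<open>(p, q)\<close> are the columns of a matrix.

  Almost every lattice contains no horizontal vector, and then has exactly one basis whose first vector
  is the lowest one above the axis in the strip \<open>\<bar>x\<bar> < s\<close> and whose second vector is normalised modulo
  the first. For \<open>s = 1\<close> the set of these bases has Haar measure
  \<open>2 \<integral>\<integral> 1 / (1 + x t) dx dt = \<pi>\<^sup>2 / 6\<close> over the unit square, which fixes the constant of proportionality. For
  \<open>s = exp (- r)\<close> the lattice lies in \<open>K r\<close> iff that lowest vector has height at least \<open>s\<close>, and these bases
  have Haar measure \<open>2 \<integral>\<integral> max 0 (1 / (1 + x t) - s\<^sup>2) dx dt\<close>. With \<open>\<epsilon> = exp (2 r) - 1\<close> this is, up to
  a factor in \<open>[(1 + \<epsilon>)\<^sup>-\<^sup>2, 1]\<close>, equal to \<open>2 \<integral>\<integral> max 0 (\<epsilon> - x t) dx dt = \<epsilon>\<^sup>2 ln (1 / \<epsilon>) + 3/2 \<epsilon>\<^sup>2\<close>.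
\<close>

section \<open>Lattices and their bases\<close>

text \<open>Nothing is known about \<open>M\<close> beyond invariance, so its value on
  \<open>K r\<close> has to come from uniqueness of Haar measure, and that argument needs a group;
  hence the lift, which has infinite mass but is sigma-finite. \<open>haar\<close> is a functional
  on nonnegative functions given by iterated integrals: each invariance reduces to affine
  substitutions in one variable and a change of order, with no integrability to check. Uniqueness
  only yields cross products, so one set of known lifted measure is required, and the strip of half
  width 1 supplies it. The same family of sets detects \<open>K r\<close>, because an open square of
  half side s misses the nonzero lattice vectors exactly when the lowest vector in the strip of half
  width s has height at least s. The determinant turns the bounds on the second column into
  inequalities such as s y (1 + x t) \<le> 1; this is where the kernel 1 / (1 + x t) comes from, and
  the hyperbola x t = \<epsilon> is the source of the logarithm.\<close>

definition mat22 :: "real \<Rightarrow> real \<Rightarrow> real \<Rightarrow> real \<Rightarrow> real^2^2" where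
  "mat22 a b c d = vector [vector [a, b], vector [c, d]]"

lemma mat22_nth [simp]:
  "mat22 a b c d $ 1 $ 1 = a" "mat22 a b c d $ 1 $ 2 = b"
  "mat22 a b c d $ 2 $ 1 = c" "mat22 a b c d $ 2 $ 2 = d"
  by (simp_all add: mat22_def vector_2)

lemma vec2_eq_iff: "(v::'a^2) = w \<longleftrightarrow> v$1 = w$1 \<and> v$2 = w$2"
  by (simp add: vec_eq_iff forall_2)

lemma mat22_eta: "mat22 (g$1$1) (g$1$2) (g$2$1) (g$2$2) = g"
  by (simp add: vec2_eq_iff)

lemma matrix_mult_nth2: "((g::real^2^2) ** h) $ i $ j = g$i$1 * h$1$j + g$i$2 * h$2$j"
  by (simp add: matrix_matrix_mult_def sum_2)

lemma matrix_vector_nth2: "((g::real^2^2) *v z) $ i = g$i$1 * z$1 + g$i$2 * z$2"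
  by (simp add: matrix_vector_mult_def sum_2)

lemma mat22_mult [simp]:
  "mat22 a b c d ** mat22 a' b' c' d' = mat22 (a*a'+b*c') (a*b'+b*d') (c*a'+d*c') (c*b'+d*d')"
  by (simp add: vec2_eq_iff matrix_mult_nth2)

lemma mat_1_eq_mat22: "mat 1 = mat22 1 0 0 1"
  by (simp add: vec2_eq_iff mat_def)

lemma SL2_iff: "g \<in> SL2 \<longleftrightarrow> g$1$1 * g$2$2 - g$1$2 * g$2$1 = 1"
  by (simp add: SL2_def det_2)

lemma SL2_mult: "g \<in> SL2 \<Longrightarrow> h \<in> SL2 \<Longrightarrow> g ** h \<in> SL2"
  by (simp add: SL2_def det_mul)

text \<open>The inverse on \<open>SL2\<close>, written as a polynomial in the entries so that
  measurability and integrality of inverses are immediate.\<close>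

definition adj2 :: "real^2^2 \<Rightarrow> real^2^2" where
  "adj2 g = mat22 (g$2$2) (- g$1$2) (- g$2$1) (g$1$1)"

lemma adj2_SL2: "g \<in> SL2 \<Longrightarrow> adj2 g \<in> SL2"
  by (simp add: SL2_iff adj2_def algebra_simps)

lemma adj2_inverse:
  assumes "g \<in> SL2"
  shows "g ** adj2 g = mat 1" "adj2 g ** g = mat 1"
  using assms by (simp_all add: SL2_iff adj2_def mat_1_eq_mat22 vec2_eq_iff matrix_mult_nth2 algebra_simps)

lemma adj2_cancel:
  assumes "g \<in> SL2"
  shows "g ** (adj2 g ** h) = (h::real^2^2)" "adj2 g ** (g ** h) = (h::real^2^2)"
    "g *v (adj2 g *v v) = v" "adj2 g *v (g *v v) = v"
  using adj2_inverse[OF assms] by (simp_all add: matrix_mul_assoc matrix_vector_mul_assoc)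

definition SL2Z :: "(real^2^2) set" where
  "SL2Z = {g \<in> SL2. \<forall>i j. g$i$j \<in> \<int>}"

lemma SL2Z_SL2: "g \<in> SL2Z \<Longrightarrow> g \<in> SL2"
  by (simp add: SL2Z_def)

lemma adj2_SL2Z: "g \<in> SL2Z \<Longrightarrow> adj2 g \<in> SL2Z"
  by (simp add: SL2Z_def adj2_SL2) (simp add: adj2_def forall_2)

lemma SL2Z_apply: "g \<in> SL2Z \<Longrightarrow> \<forall>i. z$i \<in> \<int> \<Longrightarrow> \<forall>i. (g *v z)$i \<in> \<int>"
  by (simp add: SL2Z_def matrix_vector_nth2)

lemma countable_SL2Z: "countable SL2Z"
proof -
  have "SL2Z \<subseteq> (\<lambda>(a,b,c,d). mat22 (of_int a) (of_int b) (of_int c) (of_int d)) ` (UNIV :: (int \<times> int \<times> int \<times> int) set)"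
  proof
    fix g assume "g \<in> SL2Z"
    then have "g$1$1 \<in> \<int>" "g$1$2 \<in> \<int>" "g$2$1 \<in> \<int>" "g$2$2 \<in> \<int>" by (auto simp: SL2Z_def)
    then obtain a b c d where "g$1$1 = of_int a" "g$1$2 = of_int b" "g$2$1 = of_int c" "g$2$2 = of_int d"
      by (auto simp: Ints_def)
    then have "g = mat22 (of_int a) (of_int b) (of_int c) (of_int d)" by (metis mat22_eta)
    then show "g \<in> (\<lambda>(a,b,c,d). mat22 (of_int a) (of_int b) (of_int c) (of_int d)) ` (UNIV :: (int \<times> int \<times> int \<times> int) set)"
      by (intro image_eqI[of _ _ "(a,b,c,d)"]) auto
  qed
  then show ?thesis by (rule countable_subset) simp
qed

lemma act_lat: "act h (lat g) = lat (h ** g)"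
  unfolding act_def lat_def by (auto simp: image_iff matrix_vector_mul_assoc) (metis matrix_vector_mul_assoc)

lemma lat_mult_SL2Z:
  assumes "\<gamma> \<in> SL2Z"
  shows "lat (g ** \<gamma>) = lat g"
proof -
  have "lat g \<subseteq> lat (g ** \<gamma>)"
  proof
    fix v assume "v \<in> lat g"
    then obtain z where z: "v = g *v z" "\<forall>i. z$i \<in> \<int>" by (auto simp: lat_def)
    have "v = (g ** \<gamma>) *v (adj2 \<gamma> *v z)"
      using z adj2_cancel[OF SL2Z_SL2[OF assms]] by (simp add: matrix_vector_mul_assoc[symmetric])
    then show "v \<in> lat (g ** \<gamma>)"
      using SL2Z_apply[OF adj2_SL2Z[OF assms] z(2)] by (auto simp: lat_def)
  qed
  moreover have "lat (g ** \<gamma>) \<subseteq> lat g"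
    using SL2Z_apply[OF assms] by (fastforce simp: lat_def matrix_vector_mul_assoc[symmetric])
  ultimately show ?thesis by blast
qed

definition bases :: "(real^2) set \<Rightarrow> (real^2^2) set" where
  "bases L = {g \<in> SL2. lat g = L}"

text \<open>The columns of a second basis \<open>h\<close> are lattice vectors, so
  \<open>adj2 g ** h\<close> has integer columns: the fibres of \<open>lat\<close> are cosets of
  \<open>SL2Z\<close>.\<close>

lemma bases_lat:
  assumes g: "g \<in> SL2"
  shows "bases (lat g) = (\<lambda>\<gamma>. g ** \<gamma>) ` SL2Z"
proof
  show "(\<lambda>\<gamma>. g ** \<gamma>) ` SL2Z \<subseteq> bases (lat g)"
    using g by (auto simp: bases_def lat_mult_SL2Z SL2_mult SL2Z_SL2)
  show "bases (lat g) \<subseteq> (\<lambda>\<gamma>. g ** \<gamma>) ` SL2Z"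
  proof
    fix h assume "h \<in> bases (lat g)"
    then have h: "h \<in> SL2" "lat h = lat g" by (auto simp: bases_def)
    have "(adj2 g ** h)$i$j \<in> \<int>" for i j
    proof -
      have "h *v axis j 1 \<in> lat h" by (auto simp: lat_def axis_def)
      then obtain z where z: "h *v axis j 1 = g *v z" "\<forall>i. z$i \<in> \<int>" using h(2) unfolding lat_def by blast
      then have "(adj2 g ** h) *v axis j 1 = z"
        using adj2_cancel[OF g] by (simp add: matrix_vector_mul_assoc[symmetric])
      then have "column j (adj2 g ** h) = z" by (simp add: matrix_vector_mult_basis)
      then show ?thesis using z(2) by (auto simp: column_def)
    qed
    then have "adj2 g ** h \<in> SL2Z"
      using g h by (simp add: SL2Z_def SL2_mult adj2_SL2)
    then show "h \<in> (\<lambda>\<gamma>. g ** \<gamma>) ` SL2Z"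
      using adj2_cancel[OF g] by (metis image_eqI)
  qed
qed

lemma lat_iff:
  "v \<in> lat g \<longleftrightarrow> (\<exists>m n :: int. v$1 = of_int m * g$1$1 + of_int n * g$1$2 \<and> v$2 = of_int m * g$2$1 + of_int n * g$2$2)"
proof
  assume "v \<in> lat g"
  then obtain z where z: "v = g *v z" "z$1 \<in> \<int>" "z$2 \<in> \<int>" by (auto simp: lat_def)
  then obtain m n where "z$1 = of_int m" "z$2 = of_int n" by (auto simp: Ints_def)
  then show "\<exists>m n :: int. v$1 = of_int m * g$1$1 + of_int n * g$1$2 \<and> v$2 = of_int m * g$2$1 + of_int n * g$2$2"
    using z by (auto simp: matrix_vector_nth2 mult.commute)
next
  assume "\<exists>m n :: int. v$1 = of_int m * g$1$1 + of_int n * g$1$2 \<and> v$2 = of_int m * g$2$1 + of_int n * g$2$2"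
  then obtain m n :: int where "v$1 = of_int m * g$1$1 + of_int n * g$1$2" "v$2 = of_int m * g$2$1 + of_int n * g$2$2"
    by auto
  then have "v = g *v vector [of_int m, of_int n]"
    by (simp add: vec2_eq_iff matrix_vector_nth2 vector_2 mult.commute)
  then show "v \<in> lat g" unfolding lat_def by (auto simp: forall_2 vector_2 intro!: exI[of _ "vector [of_int m, of_int n] :: real^2"])
qed

lemma lat_diff: "v \<in> lat g \<Longrightarrow> w \<in> lat g \<Longrightarrow> v - w \<in> lat g"
  unfolding lat_def by clarsimp (metis Ints_diff vector_minus_component matrix_vector_mult_diff_distrib)

lemma lat_uminus: "v \<in> lat g \<Longrightarrow> - v \<in> lat g"
  using lat_diff[of 0 g v] lat_diff[of v g v] by (auto)

lemma column_in_lat: "column j g \<in> lat g"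
  unfolding lat_def by (auto simp: axis_def matrix_vector_mult_basis[symmetric])

lemma column_nth [simp]: "column j g $ i = g$i$j"
  by (simp add: column_def)

text \<open>Dividing the two coefficients of \<open>v\<close> by their gcd leaves a coprime pair,
  and Bezout coefficients complete that pair to a matrix of determinant 1.\<close>

lemma primitive_basis:
  assumes g: "g \<in> SL2" and v: "v \<in> lat g" "v \<noteq> 0"
  obtains h k where "h \<in> bases (lat g)" "k \<ge> (1::nat)" "v = real k *\<^sub>R column 1 h"
proof -
  from v(1) obtain m n :: int where mn: "v$1 = of_int m * g$1$1 + of_int n * g$1$2"
    "v$2 = of_int m * g$2$1 + of_int n * g$2$2" unfolding lat_iff by auto
  have nz: "m \<noteq> 0 \<or> n \<noteq> 0" using v(2) mn by (auto simp: vec2_eq_iff)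
  define d where "d = gcd m n"
  have d: "d > 0" using nz by (simp add: d_def)
  obtain m' n' where m': "m = d * m'" and n': "n = d * n'"
    unfolding d_def by (metis dvdE gcd_dvd1 gcd_dvd2)
  obtain a b where ab: "a * m + b * n = d"
    unfolding d_def by (metis bezout_int)
  then have "d * (a * m' + b * n') = d * 1" by (simp add: m' n' algebra_simps)
  then have ab': "a * m' + b * n' = 1" using d by simp
  define \<gamma> where "\<gamma> = mat22 (of_int m') (of_int (-b)) (of_int n') (of_int a)"
  have "real_of_int a * m' + b * n' = 1" using ab' by (metis of_int_add of_int_mult of_int_1)
  then have \<gamma>: "\<gamma> \<in> SL2Z" by (simp add: SL2Z_def SL2_iff \<gamma>_def forall_2 algebra_simps)
  show thesis
  proof (rule that[of "g ** \<gamma>" "nat d"])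
    show "g ** \<gamma> \<in> bases (lat g)" using \<gamma> g by (auto simp: bases_lat)
    show "nat d \<ge> 1" using d by simp
    show "v = real (nat d) *\<^sub>R column 1 (g ** \<gamma>)"
      using d mn by (simp add: vec2_eq_iff matrix_mult_nth2 \<gamma>_def m' n' algebra_simps)
  qed
qed

text \<open>Two vectors of equal height differ by a horizontal one, so in such a lattice the height
  determines the vector; this makes the lowest vector unique.\<close>

definition horizontal_free :: "(real^2) set \<Rightarrow> bool" where
  "horizontal_free L \<longleftrightarrow> (\<forall>v\<in>L. v$2 = 0 \<longrightarrow> v = 0)"

lemma horizontal_basis:
  assumes "g \<in> SL2" "\<not> horizontal_free (lat g)"
  shows "\<exists>h \<in> bases (lat g). h$2$1 = 0"
proof -
  obtain v where v: "v \<in> lat g" "v$2 = 0" "v \<noteq> 0" using assms by (auto simp: horizontal_free_def)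
  obtain h k where hk: "h \<in> bases (lat g)" "k \<ge> (1::nat)" "v = real k *\<^sub>R column 1 h"
    using primitive_basis[OF assms(1) v(1,3)] .
  then show ?thesis using v by auto
qed

text \<open>The bases \<open>(v, w)\<close> of a lattice in which \<open>v\<close> is the lowest vector above the horizontal axis in the
  strip \<open>\<bar>x\<bar> < s\<close>, at height at least \<open>b\<close>, and \<open>w\<close> is normalised modulo \<open>v\<close>. Only \<open>w\<close> and \<open>w - v\<close> could
  violate minimality of \<open>v\<close>, which is what the last two conditions exclude.\<close>
definition lowest_bases :: "real \<Rightarrow> real \<Rightarrow> (real^2^2) set" where
  "lowest_bases s b = {g \<in> SL2. \<bar>g$1$1\<bar> < s \<and> b \<le> g$2$1 \<and> 0 < g$2$1 \<and> 0 \<le> g$2$2 \<and> g$2$2 < g$2$1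
     \<and> g$1$2 \<le> - s \<and> g$1$2 - g$1$1 \<le> - s}"

text \<open>The determinant is x q - p y and also x (q - y) - (p - x) y. For either sign of x, one
  of the two forms has a nonnegative first term and a second part of at least s y. This bound takes
  the place of Minkowski's theorem.\<close>

lemma lowest_bases_height:
  assumes "g \<in> lowest_bases s b"
  shows "s * g$2$1 \<le> 1"
proof -
  define x p y q where "x = g$1$1" "p = g$1$2" "y = g$2$1" "q = g$2$2"
  note d = this
  have h: "x * q - p * y = 1" "0 < y" "0 \<le> q" "q < y" "p \<le> -s" "p - x \<le> -s"
    using assms by (auto simp: lowest_bases_def SL2_iff d)
  show ?thesis
  proof (cases "x \<ge> 0")
    case True
    then have "x * q \<ge> 0" using h by simp
    moreover have "p * y \<le> - s * y" using h by (intro mult_right_mono) auto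
    ultimately show ?thesis using h by (simp add: d)
  next
    case False
    then have "x * (q - y) \<ge> 0" using h by (simp add: mult_nonpos_nonpos)
    moreover have "(p - x) * y \<le> - s * y" using h by (intro mult_right_mono) auto
    ultimately show ?thesis using h by (simp add: d algebra_simps)
  qed
qed

text \<open>The coefficient n of the second column is the determinant of the first column and the
  vector, so inside the box |n| < 2 s y \<le> 2. If n = 1, the height leaves only the second column
  or the second minus the first, and both lie outside the strip. If n = 0, the vector is a multiple
  of the first column.\<close>

lemma lowest_bases_empty_box:
  assumes g: "g \<in> lowest_bases s b" and v: "v \<in> lat g" "\<bar>v$1\<bar> < s" "\<bar>v$2\<bar> < g$2$1"
  shows "v = 0"
proof -
  define x p y q where "x = g$1$1" "p = g$1$2" "y = g$2$1" "q = g$2$2"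
  note d = this
  have h: "x * q - p * y = 1" "0 < y" "0 \<le> q" "q < y" "p \<le> -s" "p - x \<le> -s" "\<bar>x\<bar> < s"
    using g by (auto simp: lowest_bases_def SL2_iff d)
  have sy: "s * y \<le> 1" using lowest_bases_height[OF g] by (simp add: d)
  \<comment> \<open>Stated for an arbitrary \<open>w\<close> so that negative n is covered by
    applying it to \<open>-v\<close>.\<close>
  have pos: "\<not> n > 0" if w: "w$1 = of_int m * x + of_int n * p" "w$2 = of_int m * y + of_int n * q"
     "\<bar>w$1\<bar> < s" "\<bar>w$2\<bar> < y" for w :: "real^2" and m n :: int
  proof
    assume n: "n > 0"
    have "x * w$2 - y * w$1 = of_int n * (x * q - p * y)" by (simp add: w algebra_simps)
    then have e: "of_int n = x * w$2 - y * w$1" using h by simp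
    have "\<bar>x * w$2\<bar> \<le> s * y" unfolding abs_mult using h w by (intro mult_mono) auto
    moreover have "\<bar>y * w$1\<bar> < y * s" unfolding abs_mult using h w by (simp add: abs_of_pos)
    ultimately have "real_of_int n < 2" using e sy by (simp add: mult.commute)
    then have n1: "n = 1" using n by linarith
    then have "\<bar>of_int m * y + q\<bar> < y" using w by simp
    then have "of_int m * y < 1 * y" "(-2) * y < of_int m * y" using h by linarith+
    then have "real_of_int m < 1" "-2 < real_of_int m" using h(2) by (simp_all only: mult_less_cancel_right_pos)
    then have "m = 0 \<or> m = -1" by linarith
    then show False using w n1 h by auto
  qed
  from v(1) obtain m n :: int where mn: "v$1 = of_int m * x + of_int n * p"
    "v$2 = of_int m * y + of_int n * q" unfolding lat_iff d by auto
  have "\<not> n > 0" using pos[OF mn] v by (simp add: d)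
  moreover have "\<not> (-n) > 0" using pos[of "-v" "-m" "-n"] mn v by (simp add: d)
  ultimately have n: "n = 0" by simp
  have "\<bar>real_of_int m\<bar> * y < 1 * y" using mn n v(3) h(2) by (simp add: d abs_mult)
  then have "\<bar>real_of_int m\<bar> < 1" using h(2) by (simp only: mult_less_cancel_right_pos)
  then have "m = 0" by linarith
  then show ?thesis using mn n by (simp add: vec2_eq_iff)
qed

text \<open>Each first column avoids the empty box of the other basis, so their heights agree, and
  absence of horizontal vectors makes the columns equal. The determinant then forces n = 1, and the
  range of the lower right entry forces m = 0.\<close>

lemma lowest_bases_unique:
  assumes g: "g \<in> lowest_bases s b" and h: "h \<in> lowest_bases s b"
    and eq: "lat g = lat h" and L: "horizontal_free (lat g)"
  shows "g = h"
proof -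
  have "column 1 h \<noteq> 0" "column 1 g \<noteq> 0"
    using g h by (auto simp: lowest_bases_def vec2_eq_iff)
  then have "\<not> h$2$1 < g$2$1" "\<not> g$2$1 < h$2$1"
    using lowest_bases_empty_box[OF g, of "column 1 h"] lowest_bases_empty_box[OF h, of "column 1 g"]
      column_in_lat[of 1 g] column_in_lat[of 1 h] g h eq by (auto simp: lowest_bases_def)
  then have y: "g$2$1 = h$2$1" by simp
  have "column 1 g - column 1 h \<in> lat g"
    using column_in_lat[of 1 g] column_in_lat[of 1 h] eq by (auto intro: lat_diff)
  then have "column 1 g - column 1 h = 0" using L y unfolding horizontal_free_def
    by (metis column_nth diff_self vector_minus_component)
  then have x: "g$1$1 = h$1$1" by (simp add: vec2_eq_iff)
  have "column 2 h \<in> lat g" using column_in_lat[of 2 h] eq by simp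
  then obtain m n :: int where mn: "h$1$2 = of_int m * g$1$1 + of_int n * g$1$2"
    "h$2$2 = of_int m * g$2$1 + of_int n * g$2$2" unfolding lat_iff by auto
  have dg: "g$1$1 * g$2$2 - g$1$2 * g$2$1 = 1" and dh: "g$1$1 * h$2$2 - h$1$2 * g$2$1 = 1"
    using g h x y by (auto simp: lowest_bases_def SL2_iff)
  have "of_int n * (g$1$1 * g$2$2 - g$1$2 * g$2$1) = g$1$1 * h$2$2 - h$1$2 * g$2$1"
    by (simp add: mn algebra_simps)
  then have n: "n = 1" using dg dh by simp
  have "h$2$2 = of_int m * g$2$1 + g$2$2" "0 \<le> h$2$2" "h$2$2 < g$2$1" "0 \<le> g$2$2" "g$2$2 < g$2$1" "0 < g$2$1"
    using mn n g h y by (auto simp: lowest_bases_def)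
  then have "of_int m * g$2$1 < 1 * g$2$1" "(-1) * g$2$1 < of_int m * g$2$1" "0 < g$2$1" by linarith+
  then have "real_of_int m < 1" "-1 < real_of_int m" by (simp_all only: mult_less_cancel_right_pos)
  then have "m = 0" by linarith
  then show ?thesis using mn n x y by (simp add: vec2_eq_iff)
qed

text \<open>Cramer's rule: each coefficient is a difference of two products of a matrix entry and a
  coordinate of \<open>v\<close>.\<close>

lemma SL2_coeff_bound:
  assumes g: "g \<in> SL2" and v: "v$1 = of_int m * g$1$1 + of_int n * g$1$2" "v$2 = of_int m * g$2$1 + of_int n * g$2$2"
    and b: "supnorm v \<le> B" and a: "\<And>i j. \<bar>g$i$j\<bar> \<le> A"
  shows "\<bar>of_int m\<bar> \<le> 2 * A * B" "\<bar>of_int n\<bar> \<le> 2 * A * B"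
proof -
  have d: "g$1$1 * g$2$2 - g$1$2 * g$2$1 = 1" using g by (simp add: SL2_iff)
  have m: "of_int m = g$2$2 * v$1 - g$1$2 * v$2"
  proof -
    have "g$2$2 * v$1 - g$1$2 * v$2 = of_int m * (g$1$1 * g$2$2 - g$1$2 * g$2$1)" by (simp add: v algebra_simps)
    then show ?thesis using d by simp
  qed
  have n: "of_int n = g$1$1 * v$2 - g$2$1 * v$1"
  proof -
    have "g$1$1 * v$2 - g$2$1 * v$1 = of_int n * (g$1$1 * g$2$2 - g$1$2 * g$2$1)" by (simp add: v algebra_simps)
    then show ?thesis using d by simp
  qed
  have vb: "\<bar>v$1\<bar> \<le> B" "\<bar>v$2\<bar> \<le> B" using b by (auto simp: supnorm_def)
  have A: "A \<ge> 0" using a[of 1 1] by linarith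
  have k: "\<bar>g$i$j * v$1\<bar> \<le> A * B" "\<bar>g$i$j * v$2\<bar> \<le> A * B" for i j
    unfolding abs_mult using a[of i j] vb A by (auto intro!: mult_mono)
  show "\<bar>of_int m\<bar> \<le> 2 * A * B" using m k(1)[of 2 2] k(2)[of 1 2] by linarith
  show "\<bar>of_int n\<bar> \<le> 2 * A * B" using n k(1)[of 2 1] k(2)[of 1 1] by linarith
qed

section \<open>Lattice points in boxes and strips, and existence of a lowest basis\<close>

lemma entries_bounded: "\<exists>A>0. \<forall>i j. \<bar>(g::real^2^2)$i$j\<bar> \<le> A"
proof -
  have "\<bar>g$i$j\<bar> \<le> 1 + \<bar>g$1$1\<bar> + \<bar>g$1$2\<bar> + \<bar>g$2$1\<bar> + \<bar>g$2$2\<bar>" for i j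
    using exhaust_2[of i] exhaust_2[of j] by auto
  then show ?thesis by (intro exI[of _ "1 + \<bar>g$1$1\<bar> + \<bar>g$1$2\<bar> + \<bar>g$2$1\<bar> + \<bar>g$2$2\<bar>"]) auto
qed

lemma finite_lat_box:
  assumes g: "g \<in> SL2"
  shows "finite {v \<in> lat g. supnorm v \<le> B}"
proof -
  obtain A where A: "\<And>i j. \<bar>g$i$j\<bar> \<le> A" using entries_bounded[of g] by auto
  define k where "k = \<lceil>2 * A * B\<rceil>"
  have "{v \<in> lat g. supnorm v \<le> B} \<subseteq>
    (\<lambda>(m,n). vector [of_int m * g$1$1 + of_int n * g$1$2, of_int m * g$2$1 + of_int n * g$2$2]) ` ({-k..k} \<times> {-k..k})"
  proof
    fix v assume v: "v \<in> {v \<in> lat g. supnorm v \<le> B}"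
    then obtain m n :: int where mn: "v$1 = of_int m * g$1$1 + of_int n * g$1$2"
      "v$2 = of_int m * g$2$1 + of_int n * g$2$2" unfolding lat_iff by auto
    have "\<bar>of_int m\<bar> \<le> 2 * A * B" "\<bar>of_int n\<bar> \<le> 2 * A * B"
      using SL2_coeff_bound[OF g mn _ A] v by auto
    then have "m \<in> {-k..k}" "n \<in> {-k..k}" unfolding k_def by (auto simp: abs_le_iff le_ceiling_iff) linarith+
    moreover have "v = vector [of_int m * g$1$1 + of_int n * g$1$2, of_int m * g$2$1 + of_int n * g$2$2]"
      using mn by (simp add: vec2_eq_iff vector_2)
    ultimately show "v \<in> (\<lambda>(m,n). vector [of_int m * g$1$1 + of_int n * g$1$2, of_int m * g$2$1 + of_int n * g$2$2]) ` ({-k..k} \<times> {-k..k})"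
      by auto
  qed
  then show ?thesis by (rule finite_subset) simp
qed

lemma supnorm_pos: "v \<noteq> 0 \<Longrightarrow> 0 < supnorm v"
  by (auto simp: supnorm_def vec2_eq_iff)

text \<open>Unless the second column is vertical, Dirichlet approximation of
  \<open>g$1$1 / g$1$2\<close> gives an integer combination of the columns with first coordinate as
  small as desired.\<close>

lemma strip_point:
  assumes g: "g \<in> SL2" and s: "0 < s"
  obtains v where "v \<in> lat g" "v \<noteq> 0" "\<bar>v$1\<bar> < s"
proof (cases "g$1$2 = 0")
  case True
  have "column 2 g \<noteq> 0" using g by (auto simp: SL2_iff vec2_eq_iff)
  then show ?thesis using that[of "column 2 g"] True s column_in_lat by simp
next
  case False
  obtain N :: nat where N: "N > 0" "1 / real N < s / \<bar>g$1$2\<bar>"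
    by (metis False s divide_pos_pos zero_less_abs_iff inverse_eq_divide ex_inverse_of_nat_less)
  obtain q p where qp: "0 < q" "\<bar>of_int q * (g$1$1 / g$1$2) - of_int p\<bar> < 1 / real N"
    using Dirichlet_approx[OF N(1)] by metis
  define v :: "real^2" where "v = vector [of_int q * g$1$1 + of_int (-p) * g$1$2, of_int q * g$2$1 + of_int (-p) * g$2$2]"
  have v: "v$1 = of_int q * g$1$1 + of_int (-p) * g$1$2" "v$2 = of_int q * g$2$1 + of_int (-p) * g$2$2"
    by (simp_all add: v_def vector_2)
  show ?thesis
  proof (rule that[of v])
    show "v \<in> lat g" unfolding lat_iff using v by blast
    \<comment> \<open>Cramer's rule recovers q > 0 from \<open>v\<close>, so \<open>v\<close> cannot
      vanish.\<close>
    have "g$1$1 * v$2 - g$2$1 * v$1 = - of_int p * (g$1$1 * g$2$2 - g$1$2 * g$2$1)"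
      "g$2$2 * v$1 - g$1$2 * v$2 = of_int q * (g$1$1 * g$2$2 - g$1$2 * g$2$1)"
      unfolding v by (simp_all add: algebra_simps)
    then have "of_int q = g$2$2 * v$1 - g$1$2 * v$2" using g by (simp add: SL2_iff)
    then show "v \<noteq> 0" using qp by auto
    have "v$1 = g$1$2 * (of_int q * (g$1$1 / g$1$2) - of_int p)" using False by (simp add: v field_simps)
    then have "\<bar>v$1\<bar> = \<bar>g$1$2\<bar> * \<bar>of_int q * (g$1$1 / g$1$2) - of_int p\<bar>" by (simp only: abs_mult)
    also have "\<dots> < \<bar>g$1$2\<bar> * (s / \<bar>g$1$2\<bar>)" using False qp N by (intro mult_strict_left_mono) auto
    finally show "\<bar>v$1\<bar> < s" using False by simp
  qed
qed

text \<open>A lowest strip vector exists since only finitely many lie below a given one. It is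
  primitive because a proper divisor would be a lower strip vector, so it extends to a basis.
  Subtracting multiples of it normalises the second vector, and minimality pushes that vector and
  its difference with the first out of the strip.\<close>

lemma lowest_basis_exists:
  assumes g: "g \<in> SL2" and L: "horizontal_free (lat g)" and s: "0 < s"
  shows "\<exists>h\<in>lowest_bases s 0. lat h = lat g"
proof -
  obtain v0 where v0: "v0 \<in> lat g" "v0 \<noteq> 0" "\<bar>v0$1\<bar> < s" using strip_point[OF g s] .
  have v02: "v0$2 \<noteq> 0" using v0 L by (auto simp: horizontal_free_def)
  define S where "S = {v \<in> lat g. \<bar>v$1\<bar> < s \<and> 0 < v$2 \<and> v$2 \<le> \<bar>v0$2\<bar>}"
  have "S \<subseteq> {v \<in> lat g. supnorm v \<le> max s \<bar>v0$2\<bar>}" by (auto simp: S_def supnorm_def)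
  then have fin: "finite S" using finite_lat_box[OF g] finite_subset by blast
  have "v0 \<in> S \<or> - v0 \<in> S" using v0 v02 lat_uminus by (auto simp: S_def)
  then have ne: "S \<noteq> {}" by auto
  define v where "v = arg_min_on (\<lambda>v. v$2) S"
  have vS: "v \<in> S" and vmin: "\<And>w. w \<in> S \<Longrightarrow> v$2 \<le> w$2"
    using arg_min_if_finite(1)[OF fin ne] arg_min_least[OF fin ne] by (auto simp: v_def)
  then have v: "v \<in> lat g" "\<bar>v$1\<bar> < s" "0 < v$2" "v$2 \<le> \<bar>v0$2\<bar>" by (auto simp: S_def)
  have low: "v$2 \<le> w$2" if "w \<in> lat g" "\<bar>w$1\<bar> < s" "0 < w$2" for w
    using that vmin[of w] v(4) by (fastforce simp: S_def)
  have low': "s \<le> \<bar>w$1\<bar>" if "w \<in> lat g" "w$2 \<noteq> 0" "\<bar>w$2\<bar> < v$2" for w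
  proof (rule ccontr)
    assume "\<not> s \<le> \<bar>w$1\<bar>"
    then have "\<bar>w$1\<bar> < s" "\<bar>(-w)$1\<bar> < s" by auto
    moreover have "0 < w$2 \<or> 0 < (-w)$2" using that by auto
    ultimately show False using low[of w] low[of "-w"] that(1,3) lat_uminus[OF that(1)] by force
  qed
  have vn: "v \<noteq> 0" using v by auto
  obtain h k where hk: "h \<in> bases (lat g)" "k \<ge> (1::nat)" "v = real k *\<^sub>R column 1 h"
    using primitive_basis[OF g v(1) vn] .
  have h: "h \<in> SL2" "lat h = lat g" using hk by (auto simp: bases_def)
  have kv: "v$1 = real k * h$1$1" "v$2 = real k * h$2$1" using hk by auto
  have y0: "0 < h$2$1" using kv v hk by (simp add: zero_less_mult_iff)
  have "\<bar>h$1$1\<bar> * 1 \<le> \<bar>h$1$1\<bar> * real k" using hk by (intro mult_left_mono) auto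
  then have "\<bar>h$1$1\<bar> < s" using v kv by (simp add: abs_mult mult.commute)
  then have "v$2 \<le> column 1 h $ 2" using low[of "column 1 h"] column_in_lat[of 1 h] y0 h by simp
  then have "real k * h$2$1 \<le> 1 * h$2$1" using kv by simp
  then have "real k \<le> 1" using y0 by (simp only: mult_le_cancel_right_pos)
  then have "k = 1" using hk by simp
  then have vc: "v$1 = h$1$1" "v$2 = h$2$1" using kv by auto
  \<comment> \<open>The number of copies of the first column to subtract so that the new lower right
    entry falls into [0, y).\<close>
  define n where "n = \<lfloor>h$2$2 / h$2$1\<rfloor>"
  define h' where "h' = h ** mat22 1 (of_int (-n)) 0 1"
  have z: "mat22 1 (of_int (-n)) 0 1 \<in> SL2Z" by (simp add: SL2Z_def SL2_iff forall_2)
  have h': "h' \<in> SL2" "lat h' = lat g"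
    using h z lat_mult_SL2Z[OF z] by (auto simp: h'_def SL2_mult SL2Z_SL2)
  define x p y q where "x = h'$1$1" "p = h'$1$2" "y = h'$2$1" "q = h'$2$2"
  note d = this
  have xy: "x = v$1" "y = v$2" by (auto simp: d h'_def vc matrix_mult_nth2)
  have q: "q = h$2$2 - of_int n * h$2$1" by (simp add: d h'_def matrix_mult_nth2)
  have "of_int n \<le> h$2$2 / h$2$1" "h$2$2 / h$2$1 < of_int n + 1" by (auto simp: n_def)
  then have qb: "0 \<le> q" "q < y" using y0 vc unfolding q xy by (auto simp: field_simps)
  have det: "x * q - p * y = 1" using h' by (simp add: SL2_iff d)
  \<comment> \<open>Nonzero q gives both the second column and its difference with the first a
    nonzero height below y in absolute value, as \<open>low'\<close> demands.\<close>
  have q0: "q \<noteq> 0"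
  proof
    assume "q = 0"
    then have "column 2 h' = 0" using L column_in_lat[of 2 h'] h' by (auto simp: horizontal_free_def d)
    then have "p = 0" by (simp add: vec2_eq_iff d)
    then show False using det \<open>q = 0\<close> by simp
  qed
  have y: "0 < y" using v xy by simp
  have x: "\<bar>x\<bar> < s" using v xy by simp
  have "s \<le> \<bar>column 2 h' $ 1\<bar>"
    using column_in_lat[of 2 h'] h' q0 qb xy by (intro low') (auto simp: d)
  then have p1: "s \<le> \<bar>p\<bar>" by (simp add: d)
  have "s \<le> \<bar>(column 2 h' - column 1 h') $ 1\<bar>"
    using column_in_lat[of 2 h'] column_in_lat[of 1 h'] h' q0 qb xy lat_diff by (intro low') (auto simp: d)
  then have p2: "s \<le> \<bar>p - x\<bar>" by (simp add: d)
  \<comment> \<open>Minimality only gives |p| \<ge> s and |p - x| \<ge> s; the determinant excludes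
    the positive signs.\<close>
  have "\<bar>x * q\<bar> \<le> s * y" unfolding abs_mult using x qb by (intro mult_mono) auto
  then have P1: "p * y < s * y" using det by linarith
  have "\<bar>x * (q - y)\<bar> \<le> s * y" unfolding abs_mult using x qb by (intro mult_mono) auto
  moreover have "(p - x) * y = x * (q - y) - 1" using det by (simp add: algebra_simps)
  ultimately have "(p - x) * y < s * y" by linarith
  then have "p < s" "p - x < s" using P1 y by auto
  then have "p \<le> -s" "p - x \<le> -s" using p1 p2 by linarith+
  then have "h' \<in> lowest_bases s 0" using h' x y qb by (auto simp: lowest_bases_def d)
  then show ?thesis using h' by auto
qed

section \<open>The lifted measure\<close>

lemma borel_measurable_mat22 [measurable (raw)]:
  assumes [measurable]: "a \<in> borel_measurable M" "b \<in> borel_measurable M" "c \<in> borel_measurable M" "d \<in> borel_measurable M"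
  shows "(\<lambda>x. mat22 (a x) (b x) (c x) (d x)) \<in> borel_measurable M"
proof -
  have "(\<lambda>x. mat22 (a x) (b x) (c x) (d x)) =
    (\<lambda>x. a x *\<^sub>R mat22 1 0 0 0 + b x *\<^sub>R mat22 0 1 0 0 + c x *\<^sub>R mat22 0 0 1 0 + d x *\<^sub>R mat22 0 0 0 1)"
    by (simp add: fun_eq_iff vec2_eq_iff)
  then show ?thesis by simp
qed

lemma borel_measurable_entry [measurable (raw)]:
  assumes "f \<in> borel_measurable M"
  shows "(\<lambda>x. (f x :: real^2^2) $ i $ j) \<in> borel_measurable M"
  by (rule measurable_compose[OF assms], rule borel_measurable_continuous_onI) (intro continuous_intros)

lemma borel_measurable_matrix_mult [measurable (raw)]:
  assumes [measurable]: "f \<in> borel_measurable M" "g \<in> borel_measurable M"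
  shows "(\<lambda>x. (f x :: real^2^2) ** (g x :: real^2^2)) \<in> borel_measurable M"
proof -
  have "(\<lambda>x. f x ** g x) = (\<lambda>x. mat22 (f x$1$1 * g x$1$1 + f x$1$2 * g x$2$1) (f x$1$1 * g x$1$2 + f x$1$2 * g x$2$2)
    (f x$2$1 * g x$1$1 + f x$2$2 * g x$2$1) (f x$2$1 * g x$1$2 + f x$2$2 * g x$2$2))"
    by (simp add: fun_eq_iff vec2_eq_iff matrix_mult_nth2)
  then show ?thesis by simp
qed

lemma borel_measurable_adj2 [measurable (raw)]:
  assumes [measurable]: "f \<in> borel_measurable M"
  shows "(\<lambda>x. adj2 (f x)) \<in> borel_measurable M"
  unfolding adj2_def by simp

lemma SL2_borel [measurable]: "SL2 \<in> sets borel"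
proof -
  have "{g \<in> space borel. (g::real^2^2)$1$1 * g$2$2 - g$1$2 * g$2$1 = 1} \<in> sets borel" by measurable
  moreover have "SL2 = {g :: real^2^2 \<in> space borel. g$1$1 * g$2$2 - g$1$2 * g$2$1 = 1}" by (auto simp: SL2_iff)
  ultimately show ?thesis by (simp only:)
qed

lemma lowest_bases_borel [measurable]: "lowest_bases s b \<in> sets borel"
proof -
  have "{g \<in> space borel. g \<in> SL2 \<and> \<bar>g$1$1\<bar> < s \<and> b \<le> g$2$1 \<and> 0 < g$2$1 \<and> 0 \<le> g$2$2 \<and> g$2$2 < g$2$1
     \<and> g$1$2 \<le> - s \<and> g$1$2 - g$1$1 \<le> - s} \<in> sets borel" by measurable
  then show ?thesis by (simp add: lowest_bases_def)
qed

text \<open>The cardinality of \<open>A \<inter> bases L\<close>, written as an integral against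
  counting measure so that additivity and reindexing are facts about integrals.\<close>

definition basis_count :: "(real^2^2) set \<Rightarrow> (real^2) set \<Rightarrow> ennreal" where
  "basis_count A L = (\<integral>\<^sup>+g. indicator A g \<partial>count_space (bases L))"

text \<open>Replaces the varying index set \<open>bases L\<close> by the fixed countable set
  \<open>SL2Z\<close>, which makes the count measurable in \<open>g\<close>.\<close>

lemma basis_count_lat:
  assumes g: "g \<in> SL2"
  shows "basis_count A (lat g) = (\<integral>\<^sup>+\<gamma>. indicator A (g ** \<gamma>) \<partial>count_space SL2Z)"
proof -
  have "inj_on (\<lambda>\<gamma>. g ** \<gamma>) SL2Z" by (rule inj_onI) (metis adj2_cancel(2)[OF g])
  then have "bij_betw (\<lambda>\<gamma>. g ** \<gamma>) SL2Z (bases (lat g))" by (simp add: bij_betw_def bases_lat[OF g])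
  then show ?thesis unfolding basis_count_def by (rule nn_integral_bij_count_space[symmetric])
qed

lemma basis_count_lat_measurable:
  assumes [measurable]: "(A :: (real^2^2) set) \<in> sets borel"
  shows "(\<lambda>g. \<integral>\<^sup>+\<gamma>. indicator A (g ** \<gamma>) \<partial>count_space SL2Z :: ennreal) \<in> borel_measurable borel"
proof -
  interpret sigma_finite_measure "count_space SL2Z"
    by (rule sigma_finite_measure_count_space_countable[OF countable_SL2Z])
  have "(\<lambda>g. indicator A (g ** \<gamma>) :: ennreal) \<in> borel_measurable borel" for \<gamma> :: "real^2^2"
    by measurable
  then have "(\<lambda>(\<gamma>, g). indicator A (g ** \<gamma>) :: ennreal) \<in> borel_measurable (count_space SL2Z \<Otimes>\<^sub>M borel)"
    by (intro measurable_pair_measure_countable1[OF countable_SL2Z]) simp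
  then have "(\<lambda>(g, \<gamma>). indicator A (g ** \<gamma>) :: ennreal) \<in> borel_measurable (borel \<Otimes>\<^sub>M count_space SL2Z)"
    by (subst measurable_pair_swap_iff) (simp add: split_beta)
  then show ?thesis by (rule borel_measurable_nn_integral)
qed

lemma bases_act:
  assumes h: "h \<in> SL2" and L: "L \<in> unimod_lattices"
  shows "bases (act h L) = (\<lambda>g. h ** g) ` bases L"
proof -
  obtain g where g: "g \<in> SL2" "L = lat g" using L by (auto simp: unimod_lattices_def)
  show ?thesis using g h by (simp add: act_lat bases_lat SL2_mult image_image matrix_mul_assoc)
qed

lemma basis_count_act:
  assumes h: "h \<in> SL2" and L: "L \<in> unimod_lattices"
  shows "basis_count A (act h L) = basis_count {g. h ** g \<in> A} L"
proof -
  have "inj_on (\<lambda>g. h ** g) (bases L)" by (rule inj_onI) (metis adj2_cancel(2)[OF h])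
  then have "bij_betw (\<lambda>g. h ** g) (bases L) (bases (act h L))" by (simp add: bij_betw_def bases_act[OF h L])
  from nn_integral_bij_count_space[OF this, of "indicator A"]
  show ?thesis unfolding basis_count_def by (simp add: indicator_def[abs_def])
qed

lemma act_unimod: "h \<in> SL2 \<Longrightarrow> L \<in> unimod_lattices \<Longrightarrow> act h L \<in> unimod_lattices"
  by (auto simp: unimod_lattices_def act_lat SL2_mult)

lemma act_adj2:
  assumes "h \<in> SL2"
  shows "act h (act (adj2 h) L) = L" "act (adj2 h) (act h L) = L"
  by (simp_all add: act_def image_image adj2_cancel[OF assms])

lemma basis_count_sums:
  assumes "disjoint_family A"
  shows "(\<Sum>i. basis_count (A i) L) = basis_count (\<Union>i. A i) L"
proof -
  have "(\<Sum>i. basis_count (A i) L) = (\<integral>\<^sup>+g. (\<Sum>i. indicator (A i) g) \<partial>count_space (bases L))"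
    unfolding basis_count_def by (rule nn_integral_suminf[symmetric]) simp
  then show ?thesis by (simp add: basis_count_def suminf_indicator[OF assms])
qed

text \<open>The lift of \<open>M\<close> along the covering \<open>SL\<^sub>2(\<real>) \<rightarrow> SL\<^sub>2(\<real>) / SL\<^sub>2(\<int>)\<close>.\<close>
definition basis_measure :: "(real^2) set measure \<Rightarrow> (real^2^2) measure" where
  "basis_measure M = measure_of UNIV (sets borel) (\<lambda>A. \<integral>\<^sup>+L. basis_count A L \<partial>M)"

lemma sets_basis_measure [measurable_cong, simp]: "sets (basis_measure M) = sets borel"
  by (simp add: basis_measure_def sets.sigma_sets_eq[of borel, simplified])

lemma space_basis_measure [simp]: "space (basis_measure M) = UNIV"
  by (simp add: basis_measure_def)

text \<open>If two bases of \<open>L\<close> have entries of size at most n, the integer matrix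
  relating them has entries at most 2 n^2, and only finitely many integer matrices do. The bound is
  uniform in \<open>L\<close>, which gives sigma-finiteness of the lift.\<close>

lemma basis_count_bounded_le:
  assumes L: "L \<in> unimod_lattices"
  shows "basis_count {g. \<forall>i j. \<bar>g$i$j\<bar> \<le> real n} L \<le> of_nat (card {\<gamma> \<in> SL2Z. \<forall>i j. \<bar>\<gamma>$i$j\<bar> \<le> 2 * real n ^ 2})"
proof -
  define B where "B = {\<gamma> \<in> SL2Z. \<forall>i j. \<bar>\<gamma>$i$j\<bar> \<le> 2 * real n ^ 2}"
  define A where "A = {g :: real^2^2. \<forall>i j. \<bar>g$i$j\<bar> \<le> real n}"
  define k where "k = \<lceil>2 * real n ^ 2\<rceil>"
  have "B \<subseteq> (\<lambda>(a,b,c,d). mat22 (of_int a) (of_int b) (of_int c) (of_int d)) ` ({-k..k} \<times> {-k..k} \<times> {-k..k} \<times> {-k..k})"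
  proof
    fix g assume g: "g \<in> B"
    have *: "\<exists>a\<in>{-k..k}. g$i$j = of_int a" for i j
    proof -
      have "g$i$j \<in> \<int>" "\<bar>g$i$j\<bar> \<le> 2 * real n ^ 2" using g by (auto simp: B_def SL2Z_def)
      then obtain a where a: "g$i$j = of_int a" "\<bar>of_int a\<bar> \<le> 2 * real n ^ 2" by (auto simp: Ints_def)
      then have "a \<in> {-k..k}" unfolding k_def by (auto simp: abs_le_iff le_ceiling_iff) linarith+
      then show ?thesis using a by auto
    qed
    obtain a b c d where "a \<in> {-k..k}" "b \<in> {-k..k}" "c \<in> {-k..k}" "d \<in> {-k..k}"
      and e: "g$1$1 = of_int a" "g$1$2 = of_int b" "g$2$1 = of_int c" "g$2$2 = of_int d"
      using *[of 1 1] *[of 1 2] *[of 2 1] *[of 2 2] by auto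
    moreover have "g = mat22 (of_int a) (of_int b) (of_int c) (of_int d)" using e by (metis mat22_eta)
    ultimately show "g \<in> (\<lambda>(a,b,c,d). mat22 (of_int a) (of_int b) (of_int c) (of_int d)) ` ({-k..k} \<times> {-k..k} \<times> {-k..k} \<times> {-k..k})"
      by (intro image_eqI[of _ _ "(a,b,c,d)"]) auto
  qed
  then have fin: "finite B" by (rule finite_subset) simp
  have "basis_count A L \<le> of_nat (card B)"
  proof (cases "A \<inter> bases L = {}")
    case True
    then have "basis_count A L = (\<integral>\<^sup>+g. 0 \<partial>count_space (bases L))"
      unfolding basis_count_def by (intro nn_integral_cong) (auto simp: indicator_def)
    then show ?thesis by simp
  next
    case False
    then obtain g where g: "g \<in> A" "g \<in> SL2" "L = lat g" by (auto simp: bases_def)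
    have sub: "A \<inter> bases L \<subseteq> (\<lambda>\<gamma>. g ** \<gamma>) ` B"
    proof
      fix h assume h: "h \<in> A \<inter> bases L"
      then obtain \<gamma> where \<gamma>: "\<gamma> \<in> SL2Z" "h = g ** \<gamma>" using bases_lat[OF g(2)] g(3) by auto
      have e: "\<gamma> = adj2 g ** h" by (simp add: \<gamma>(2) adj2_cancel(2)[OF g(2)])
      have "\<bar>adj2 g$i$j\<bar> \<le> real n" "\<bar>h$i$j\<bar> \<le> real n" for i j
        using g(1) h exhaust_2[of i] exhaust_2[of j] by (auto simp: A_def adj2_def)
      then have "\<bar>adj2 g$i$l * h$l$j\<bar> \<le> real n * real n" for i j l
        unfolding abs_mult by (intro mult_mono) auto
      then have "\<bar>adj2 g$i$1 * h$1$j + adj2 g$i$2 * h$2$j\<bar> \<le> real n * real n + real n * real n" for i j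
        by (meson abs_triangle_ineq add_mono order_trans)
      then have "\<bar>\<gamma>$i$j\<bar> \<le> 2 * real n ^ 2" for i j
        unfolding e matrix_mult_nth2 by (simp add: power2_eq_square)
      then show "h \<in> (\<lambda>\<gamma>. g ** \<gamma>) ` B" using \<gamma> by (auto simp: B_def)
    qed
    then have fin': "finite (A \<inter> bases L)" using fin finite_surj by blast
    have "basis_count A L = (\<integral>\<^sup>+g. indicator (A \<inter> bases L) g \<partial>count_space (bases L))"
      unfolding basis_count_def by (intro nn_integral_cong) (auto simp: indicator_def)
    also have "\<dots> = of_nat (card (A \<inter> bases L))" using fin' by simp
    also have "\<dots> \<le> of_nat (card B)" using surj_card_le[OF fin sub] by simp
    finally show ?thesis .
  qed
  then show "basis_count {g. \<forall>i j. \<bar>g$i$j\<bar> \<le> real n} L \<le> of_nat (card {\<gamma> \<in> SL2Z. \<forall>i j. \<bar>\<gamma>$i$j\<bar> \<le> 2 * real n ^ 2})"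
    by (simp add: A_def B_def)
qed

section \<open>Left invariance and sigma-finiteness of the lift\<close>

context
  fixes M assumes inv: "invariant_prob M"
begin

lemma invariant_prob_facts: "prob_space M" "space M = unimod_lattices" "sets M = lattice_sets"
  using inv by (auto simp: invariant_prob_def)

text \<open>Sets of \<open>M\<close> are tested by pulling back along \<open>lat\<close>, and on
  \<open>SL2\<close> the pullback of \<open>f\<close> is the Borel function
  \<open>k\<close>.\<close>

lemma measurable_lattice:
  fixes f :: "(real^2) set \<Rightarrow> 'b::topological_space"
  assumes [measurable]: "k \<in> borel_measurable borel" and eq: "\<And>g. g \<in> SL2 \<Longrightarrow> f (lat g) = k g"
  shows "f \<in> borel_measurable M"
proof (rule measurableI)
  fix S :: "'b set" assume S [measurable]: "S \<in> sets borel"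
  have "{g \<in> SL2. lat g \<in> f -` S \<inter> unimod_lattices} = SL2 \<inter> (k -` S \<inter> space borel)"
    using eq by (auto simp: unimod_lattices_def)
  moreover have "SL2 \<inter> (k -` S \<inter> space borel) \<in> sets borel" by measurable
  ultimately show "f -` S \<inter> space M \<in> sets M"
    unfolding invariant_prob_facts lattice_sets_def by simp
qed simp

lemma basis_count_measurable:
  assumes "A \<in> sets borel"
  shows "basis_count A \<in> borel_measurable M"
  by (rule measurable_lattice[OF basis_count_lat_measurable[OF assms]]) (rule basis_count_lat)

lemma emeasure_basis_measure:
  assumes A: "A \<in> sets borel"
  shows "emeasure (basis_measure M) A = (\<integral>\<^sup>+L. basis_count A L \<partial>M)"
proof (rule emeasure_measure_of[OF basis_measure_def])
  show "sets borel \<subseteq> Pow (UNIV :: (real^2^2) set)" by simp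
  show "A \<in> sets (basis_measure M)" using A by simp
  show "positive (sets (basis_measure M)) (\<lambda>A. \<integral>\<^sup>+L. basis_count A L \<partial>M)"
    by (simp add: positive_def basis_count_def)
  show "countably_additive (sets (basis_measure M)) (\<lambda>A. \<integral>\<^sup>+L. basis_count A L \<partial>M)"
  proof (rule countably_additiveI)
    fix A :: "nat \<Rightarrow> (real^2^2) set"
    assume A: "range A \<subseteq> sets (basis_measure M)" "disjoint_family A"
    have "(\<Sum>i. \<integral>\<^sup>+L. basis_count (A i) L \<partial>M) = (\<integral>\<^sup>+L. (\<Sum>i. basis_count (A i) L) \<partial>M)"
      using A by (intro nn_integral_suminf[symmetric] basis_count_measurable) auto
    then show "(\<Sum>i. \<integral>\<^sup>+L. basis_count (A i) L \<partial>M) = (\<integral>\<^sup>+L. basis_count (\<Union>i. A i) L \<partial>M)"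
      by (simp add: basis_count_sums[OF A(2)])
  qed
qed

lemma act_measurable:
  assumes h: "h \<in> SL2"
  shows "act h \<in> measurable M M"
proof (rule measurableI)
  show "act h L \<in> space M" if "L \<in> space M" for L using that act_unimod[OF h] by (simp add: invariant_prob_facts)
  fix A assume "A \<in> sets M"
  then have A: "A \<subseteq> unimod_lattices" and [measurable]: "{g \<in> SL2. lat g \<in> A} \<in> sets borel"
    by (auto simp: invariant_prob_facts lattice_sets_def)
  have "{g \<in> SL2. lat g \<in> act h -` A \<inter> unimod_lattices} = SL2 \<inter> ((\<lambda>g. h ** g) -` {g \<in> SL2. lat g \<in> A} \<inter> space borel)"
    using h by (auto simp: unimod_lattices_def act_lat SL2_mult)
  moreover have "SL2 \<inter> ((\<lambda>g. h ** g) -` {g \<in> SL2. lat g \<in> A} \<inter> space borel) \<in> sets borel" by measurable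
  ultimately show "act h -` A \<inter> space M \<in> sets M" by (simp add: invariant_prob_facts lattice_sets_def)
qed

text \<open>Invariance is postulated for images of sets; a preimage under \<open>act h\<close> is an
  image under the inverse action, which converts it to a pushforward.\<close>

lemma distr_act:
  assumes h: "h \<in> SL2"
  shows "distr M M (act h) = M"
proof (rule measure_eqI)
  fix A assume "A \<in> sets (distr M M (act h))"
  then have A: "A \<in> sets M" by simp
  have sub: "A \<subseteq> unimod_lattices" using A by (auto simp: invariant_prob_facts lattice_sets_def)
  have "act h -` A \<inter> space M = act (adj2 h) ` A"
  proof (intro equalityI subsetI)
    fix L assume L: "L \<in> act h -` A \<inter> space M"
    have "L = act (adj2 h) (act h L)" by (simp only: act_adj2[OF h])
    then show "L \<in> act (adj2 h) ` A" using L by blast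
  next
    fix L assume "L \<in> act (adj2 h) ` A"
    then obtain L' where "L' \<in> A" "L = act (adj2 h) L'" by blast
    then show "L \<in> act h -` A \<inter> space M"
      using sub act_unimod[OF adj2_SL2[OF h]] by (auto simp: invariant_prob_facts act_adj2[OF h])
  qed
  then show "emeasure (distr M M (act h)) A = emeasure M A"
    using A inv adj2_SL2[OF h] by (simp add: emeasure_distr act_measurable[OF h] invariant_prob_def)
qed simp

text \<open>Bases g of L with h g in A correspond to bases of h L in A, so a translation upstairs
  becomes the action on lattices, which preserves \<open>M\<close>.\<close>

lemma basis_measure_left_invariant:
  assumes h: "h \<in> SL2"
  shows "distr (basis_measure M) borel (\<lambda>g. h ** g) = basis_measure M"
proof (rule measure_eqI)
  fix A assume "A \<in> sets (distr (basis_measure M) borel (\<lambda>g. h ** g))"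
  then have A [measurable]: "A \<in> sets borel" by simp
  have [measurable]: "{g. h ** g \<in> A} \<in> sets borel"
    using measurable_sets[of "\<lambda>g. h ** g" borel borel A] by (simp add: vimage_def)
  have "emeasure (distr (basis_measure M) borel (\<lambda>g. h ** g)) A = emeasure (basis_measure M) {g. h ** g \<in> A}"
    by (subst emeasure_distr) (auto simp: vimage_def)
  also have "\<dots> = (\<integral>\<^sup>+L. basis_count {g. h ** g \<in> A} L \<partial>M)" by (simp add: emeasure_basis_measure)
  also have "\<dots> = (\<integral>\<^sup>+L. basis_count A (act h L) \<partial>M)"
    by (intro nn_integral_cong) (simp add: basis_count_act[OF h] invariant_prob_facts)
  also have "\<dots> = (\<integral>\<^sup>+L. basis_count A L \<partial>distr M M (act h))"
    using basis_count_measurable[OF A] by (simp add: nn_integral_distr act_measurable[OF h])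
  also have "\<dots> = emeasure (basis_measure M) A" by (simp add: distr_act[OF h] emeasure_basis_measure)
  finally show "emeasure (distr (basis_measure M) borel (\<lambda>g. h ** g)) A = emeasure (basis_measure M) A" .
qed simp

lemma AE_basis_measure_SL2: "AE g in basis_measure M. g \<in> SL2"
proof (rule AE_I[of _ _ "- SL2"])
  have "basis_count (- SL2) L = (\<integral>\<^sup>+g. 0 \<partial>count_space (bases L))" for L
    unfolding basis_count_def by (intro nn_integral_cong) (auto simp: bases_def)
  then show "emeasure (basis_measure M) (- SL2) = 0" by (simp add: emeasure_basis_measure borel_comp)
  show "- SL2 \<in> sets (basis_measure M)" by (simp add: borel_comp)
qed auto

text \<open>Boxes of matrices with entries at most n exhaust the space, and each has finite measure
  because \<open>M\<close> has mass 1 and the count is bounded uniformly in the lattice.\<close>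

lemma sigma_finite_basis_measure: "sigma_finite_measure (basis_measure M)"
proof
  interpret prob_space M by (rule invariant_prob_facts)
  define A where "A n = {g :: real^2^2. \<forall>i j. \<bar>g$i$j\<bar> \<le> real n}" for n
  have [measurable]: "A n \<in> sets borel" for n
  proof -
    have "{g \<in> space borel. \<forall>i j. \<bar>(g :: real^2^2)$i$j\<bar> \<le> real n} \<in> sets borel" by measurable
    then show ?thesis by (simp add: A_def)
  qed
  have "emeasure (basis_measure M) (A n) \<noteq> \<infinity>" for n
  proof -
    have "emeasure (basis_measure M) (A n) \<le> (\<integral>\<^sup>+L. of_nat (card {\<gamma> \<in> SL2Z. \<forall>i j. \<bar>\<gamma>$i$j\<bar> \<le> 2 * real n ^ 2}) \<partial>M)"
      using basis_count_bounded_le[of _ n] by (simp add: emeasure_basis_measure A_def[symmetric] invariant_prob_facts del: nn_integral_const cong: nn_integral_cong)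
        (intro nn_integral_mono, simp add: invariant_prob_facts A_def)
    also have "\<dots> < \<infinity>" by (simp add: emeasure_space_1 ennreal_mult_less_top of_nat_less_top)
    finally show ?thesis by simp
  qed
  moreover have "(\<Union>n. A n) = UNIV"
  proof -
    have "\<exists>n. g \<in> A n" for g :: "real^2^2"
    proof -
      obtain B where "\<And>i j. \<bar>g$i$j\<bar> \<le> B" using entries_bounded[of g] by auto
      moreover obtain n where "B \<le> real n" using real_arch_simple by auto
      ultimately show ?thesis unfolding A_def by (auto intro: order_trans)
    qed
    then show ?thesis by auto
  qed
  ultimately show "\<exists>A. countable A \<and> A \<subseteq> sets (basis_measure M) \<and> \<Union> A = space (basis_measure M) \<and>
      (\<forall>a\<in>A. emeasure (basis_measure M) a \<noteq> \<infinity>)"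
    by (intro exI[of _ "range A"]) auto
qed

end

section \<open>Haar measure\<close>

text \<open>Haar measure on \<open>SL\<^sub>2(\<real>)\<close> in the coordinates \<open>(x, y, q)\<close>, the missing entry being determined by
  the determinant. At \<open>y = 0\<close> the density \<open>1 / \<bar>y\<bar>\<close> has the junk value 0.\<close>
definition haar_mat :: "real \<Rightarrow> real \<Rightarrow> real \<Rightarrow> real^2^2" where
  "haar_mat x y q = mat22 x ((x * q - 1) / y) y q"

definition haar :: "(real^2^2 \<Rightarrow> ennreal) \<Rightarrow> ennreal" where
  "haar f = (\<integral>\<^sup>+y. \<integral>\<^sup>+q. \<integral>\<^sup>+x. ennreal (1 / \<bar>y\<bar>) * f (haar_mat x y q) \<partial>lborel \<partial>lborel \<partial>lborel)"

lemma borel_measurable_haar_mat [measurable (raw)]: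
  assumes [measurable]: "a \<in> borel_measurable M" "b \<in> borel_measurable M" "c \<in> borel_measurable M"
  shows "(\<lambda>x. haar_mat (a x) (b x) (c x)) \<in> borel_measurable M"
  unfolding haar_mat_def by simp

lemma haar_mat_SL2: "y \<noteq> 0 \<Longrightarrow> haar_mat x y q \<in> SL2"
  by (simp add: SL2_iff haar_mat_def)

section \<open>Invariance of Haar measure under right translation and inversion\<close>

lemma nn_integral_shift:
  fixes f :: "real \<Rightarrow> ennreal"
  assumes "f \<in> borel_measurable borel"
  shows "(\<integral>\<^sup>+x. f (x + t) \<partial>lborel) = (\<integral>\<^sup>+x. f x \<partial>lborel)"
  using nn_integral_real_affine[OF assms, of 1 t] by (simp add: add.commute)

lemma nn_integral_reflect:
  fixes f :: "real \<Rightarrow> ennreal"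
  assumes "f \<in> borel_measurable borel"
  shows "(\<integral>\<^sup>+x. f (- x) \<partial>lborel) = (\<integral>\<^sup>+x. f x \<partial>lborel)"
  using nn_integral_real_affine[OF assms, of "-1" 0] by simp

text \<open>The first column is fixed and q moves to q + c y, a translation once x and y are held
  constant.\<close>

lemma haar_upper_shear:
  assumes [measurable]: "f \<in> borel_measurable borel"
  shows "haar (\<lambda>h. f (h ** mat22 1 c 0 1)) = haar f"
proof -
  have "(\<integral>\<^sup>+q. \<integral>\<^sup>+x. ennreal (1 / \<bar>y\<bar>) * f (haar_mat x y q ** mat22 1 c 0 1) \<partial>lborel \<partial>lborel)
      = (\<integral>\<^sup>+q. \<integral>\<^sup>+x. ennreal (1 / \<bar>y\<bar>) * f (haar_mat x y q) \<partial>lborel \<partial>lborel)" (is "?l = ?r") for y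
  proof (cases "y = 0")
    case False
    then have e: "haar_mat x y q ** mat22 1 c 0 1 = haar_mat x y (q + c * y)" for x q
      by (simp add: haar_mat_def field_simps)
    have "?l = (\<integral>\<^sup>+x. \<integral>\<^sup>+q. ennreal (1 / \<bar>y\<bar>) * f (haar_mat x y (q + c * y)) \<partial>lborel \<partial>lborel)"
      unfolding e by (rule lborel_pair.Fubini') measurable
    also have "\<dots> = (\<integral>\<^sup>+x. \<integral>\<^sup>+q. ennreal (1 / \<bar>y\<bar>) * f (haar_mat x y q) \<partial>lborel \<partial>lborel)"
      by (intro nn_integral_cong nn_integral_shift) measurable
    also have "\<dots> = ?r" by (rule lborel_pair.Fubini') measurable
    finally show ?thesis .
  qed simp
  then show ?thesis unfolding haar_def by simp
qed

text \<open>With q fixed, y moves to y + c q and x is scaled by k = (y + c q) / y and translated.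
  The Jacobian |k| is exactly what turns the density 1 / |y + c q| into 1 / |y|.\<close>

lemma haar_lower_shear:
  assumes [measurable]: "f \<in> borel_measurable borel"
  shows "haar (\<lambda>h. f (h ** mat22 1 0 c 1)) = haar f"
proof -
  define G where "G y q = (\<integral>\<^sup>+x. ennreal (1 / \<bar>y\<bar>) * f (haar_mat x y q) \<partial>lborel)" for y q
  define G' where "G' y q = (\<integral>\<^sup>+x. ennreal (1 / \<bar>y\<bar>) * f (haar_mat x y q ** mat22 1 0 c 1) \<partial>lborel)" for y q
  have [measurable]: "case_prod G \<in> borel_measurable (borel \<Otimes>\<^sub>M borel)" unfolding G_def by measurable
  have [measurable]: "case_prod G' \<in> borel_measurable (borel \<Otimes>\<^sub>M borel)" unfolding G'_def by measurable
  have *: "G' y q = G (y + c * q) q" if y: "y \<noteq> 0" and y': "y + c * q \<noteq> 0" for y q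
  proof -
    define k where "k = (y + c * q) / y"
    have k: "k \<noteq> 0" using y y' by (simp add: k_def)
    have e: "haar_mat x y q ** mat22 1 0 c 1 = haar_mat (- c / y + k * x) (y + c * q) q" for x
    proof -
      have "x + (x * q - 1) / y * c = - c / y + k * x" using y by (simp add: k_def field_simps)
      moreover have "(- c / y + k * x) * q - 1 = (x * q - 1) / y * (y + c * q)" using y by (simp add: k_def field_simps)
      then have "((- c / y + k * x) * q - 1) / (y + c * q) = (x * q - 1) / y" using y' by simp
      ultimately show ?thesis by (simp add: haar_mat_def mult.commute)
    qed
    have "G (y + c * q) q = \<bar>k\<bar> * (\<integral>\<^sup>+x. ennreal (1 / \<bar>y + c * q\<bar>) * f (haar_mat (- c / y + k * x) (y + c * q) q) \<partial>lborel)"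
      unfolding G_def by (rule nn_integral_real_affine[OF _ k]) measurable
    also have "\<dots> = (\<integral>\<^sup>+x. \<bar>k\<bar> * (ennreal (1 / \<bar>y + c * q\<bar>) * f (haar_mat (- c / y + k * x) (y + c * q) q)) \<partial>lborel)"
      by (rule nn_integral_cmult[symmetric]) measurable
    also have "\<dots> = G' y q"
    proof -
      have "ennreal \<bar>k\<bar> * ennreal (1 / \<bar>y + c * q\<bar>) = ennreal (1 / \<bar>y\<bar>)"
        using y y' by (subst ennreal_mult[symmetric]) (auto simp: k_def abs_divide)
      then show ?thesis unfolding G'_def e by (simp add: mult.assoc[symmetric])
    qed
    finally show ?thesis by simp
  qed
  have "haar (\<lambda>h. f (h ** mat22 1 0 c 1)) = (\<integral>\<^sup>+y. \<integral>\<^sup>+q. G' y q \<partial>lborel \<partial>lborel)"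
    by (simp add: haar_def G'_def)
  also have "\<dots> = (\<integral>\<^sup>+q. \<integral>\<^sup>+y. G' y q \<partial>lborel \<partial>lborel)"
    by (rule lborel_pair.Fubini') measurable
  also have "\<dots> = (\<integral>\<^sup>+q. \<integral>\<^sup>+y. G (y + c * q) q \<partial>lborel \<partial>lborel)"
  proof (rule nn_integral_cong, rule nn_integral_cong_AE)
    fix q
    show "AE y in lborel. G' y q = G (y + c * q) q"
      \<comment> \<open>Both the old and the new lower left entry must be nonzero; for fixed q this
        excludes two values of y.\<close>
      using AE_lborel_singleton[of 0] AE_lborel_singleton[of "- c * q"]
      by eventually_elim (rule *, auto)
  qed
  also have "\<dots> = (\<integral>\<^sup>+q. \<integral>\<^sup>+y. G y q \<partial>lborel \<partial>lborel)"
    by (rule nn_integral_cong, rule nn_integral_shift) measurable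
  also have "\<dots> = (\<integral>\<^sup>+y. \<integral>\<^sup>+q. G y q \<partial>lborel \<partial>lborel)"
    by (rule lborel_pair.Fubini') measurable
  finally show ?thesis by (simp add: haar_def G_def)
qed

text \<open>Inversion exchanges x and q and negates y, and the density is even in y.\<close>

lemma haar_adj2:
  assumes [measurable]: "f \<in> borel_measurable borel"
  shows "haar (\<lambda>h. f (adj2 h)) = haar f"
proof -
  have e: "adj2 (haar_mat x y q) = haar_mat q (- y) x" for x y q
    by (simp add: adj2_def haar_mat_def minus_divide_left mult.commute)
  define G where "G y = (\<integral>\<^sup>+q. \<integral>\<^sup>+x. ennreal (1 / \<bar>y\<bar>) * f (haar_mat x y q) \<partial>lborel \<partial>lborel)" for y
  have [measurable]: "G \<in> borel_measurable borel" unfolding G_def by measurable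
  have "haar (\<lambda>h. f (adj2 h)) = (\<integral>\<^sup>+y. \<integral>\<^sup>+q. \<integral>\<^sup>+x. ennreal (1 / \<bar>y\<bar>) * f (haar_mat q (- y) x) \<partial>lborel \<partial>lborel \<partial>lborel)"
    by (simp add: haar_def e)
  also have "\<dots> = (\<integral>\<^sup>+y. G (- y) \<partial>lborel)"
    unfolding G_def abs_minus_cancel by (intro nn_integral_cong lborel_pair.Fubini') measurable
  also have "\<dots> = haar f" by (subst nn_integral_reflect, measurable) (simp add: G_def[abs_def] haar_def)
  finally show ?thesis .
qed

text \<open>Upper and lower shears generate \<open>SL\<^sub>2(\<real>)\<close>.\<close>
lemma haar_right_invariant:
  assumes f [measurable]: "f \<in> borel_measurable borel" and g: "g \<in> SL2"
  shows "haar (\<lambda>h. f (h ** g)) = haar f"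
proof -
  have shears: "haar (\<lambda>h. f (h ** g)) = haar f"
    if f [measurable]: "f \<in> borel_measurable borel" and g: "g \<in> SL2" and c: "g$2$1 \<noteq> 0" for f g
  proof -
    \<comment> \<open>Upper times lower times upper: the lower shear carries \<open>g$2$1\<close>,
      and the diagonal entries of \<open>g\<close> determine the two upper shears.\<close>
    define u v w where "u = mat22 1 ((g$1$1 - 1) / g$2$1) 0 1" "v = mat22 1 0 (g$2$1) 1" "w = mat22 1 ((g$2$2 - 1) / g$2$1) 0 1"
    note d = this
    have e: "g = u ** (v ** w)"
      using c g by (simp add: d SL2_iff vec2_eq_iff field_simps)
    have "haar (\<lambda>h. f (h ** g)) = haar (\<lambda>h. f (((h ** u) ** v) ** w))"
      by (simp add: e matrix_mul_assoc)
    also have "\<dots> = haar (\<lambda>h. f ((h ** v) ** w))"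
      unfolding d by (rule haar_upper_shear[of "\<lambda>h. f ((h ** _) ** _)"]) measurable
    also have "\<dots> = haar (\<lambda>h. f (h ** w))"
      unfolding d by (rule haar_lower_shear[of "\<lambda>h. f (h ** _)"]) measurable
    also have "\<dots> = haar f" unfolding d by (rule haar_upper_shear) measurable
    finally show ?thesis .
  qed
  show ?thesis
  proof (cases "g$2$1 = 0")
    case True
    \<comment> \<open>An upper triangular \<open>g\<close> is written as (g l) l^-1; the lower left
      entries of the factors are \<open>g$2$2\<close>, which is nonzero, and -1.\<close>
    define l where "l = mat22 1 0 1 1"
    have l: "l \<in> SL2" by (simp add: l_def SL2_iff)
    have "g ** l \<in> SL2" using g l by (rule SL2_mult)
    moreover have "(g ** l)$2$1 \<noteq> 0" using True g by (auto simp: l_def matrix_mult_nth2 SL2_iff)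
    ultimately have "haar (\<lambda>h. f ((h ** (g ** l)) ** adj2 l)) = haar (\<lambda>h. f (h ** adj2 l))"
      by (intro shears[of "\<lambda>h. f (h ** adj2 l)"]) auto
    moreover have "haar (\<lambda>h. f (h ** adj2 l)) = haar f"
      by (rule shears[OF f adj2_SL2[OF l]]) (simp add: l_def adj2_def)
    moreover have "(h ** (g ** l)) ** adj2 l = h ** g" for h :: "real^2^2"
      using adj2_inverse[OF l] by (simp add: matrix_mul_assoc[symmetric])
    ultimately show ?thesis by (simp only:)
  qed (rule shears[OF f g])
qed

text \<open>As one integral over R^3, \<open>haar\<close> can be exchanged with another sigma-finite
  integral in a single application of Fubini.\<close>

lemma haar_eq_nn_integral:
  assumes [measurable]: "f \<in> borel_measurable borel"
  shows "haar f = (\<integral>\<^sup>+z. ennreal (1 / \<bar>fst z\<bar>) * f (haar_mat (snd (snd z)) (fst z) (fst (snd z)))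
    \<partial>(lborel :: (real \<times> real \<times> real) measure))"
proof -
  have "haar f = (\<integral>\<^sup>+y. \<integral>\<^sup>+z. ennreal (1 / \<bar>y\<bar>) * f (haar_mat (snd z) y (fst z)) \<partial>(lborel \<Otimes>\<^sub>M lborel) \<partial>lborel)"
    unfolding haar_def
  proof (rule nn_integral_cong)
    fix y
    have "(\<lambda>z. ennreal (1 / \<bar>y\<bar>) * f (haar_mat (snd z) y (fst z))) \<in> borel_measurable (lborel \<Otimes>\<^sub>M lborel)" by measurable
    from lborel.nn_integral_fst[OF this]
    show "(\<integral>\<^sup>+q. \<integral>\<^sup>+x. ennreal (1 / \<bar>y\<bar>) * f (haar_mat x y q) \<partial>lborel \<partial>lborel)
      = (\<integral>\<^sup>+z. ennreal (1 / \<bar>y\<bar>) * f (haar_mat (snd z) y (fst z)) \<partial>(lborel \<Otimes>\<^sub>M lborel))" by simp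
  qed
  also have "\<dots> = (\<integral>\<^sup>+y. \<integral>\<^sup>+z. ennreal (1 / \<bar>y\<bar>) * f (haar_mat (snd z) y (fst z)) \<partial>lborel \<partial>lborel)"
    by (simp only: lborel_prod)
  also have "\<dots> = (\<integral>\<^sup>+z. ennreal (1 / \<bar>fst z\<bar>) * f (haar_mat (snd (snd z)) (fst z) (fst (snd z)))
    \<partial>(lborel \<Otimes>\<^sub>M lborel))"
  proof -
    have "(\<lambda>z. ennreal (1 / \<bar>fst z\<bar>) * f (haar_mat (snd (snd z)) (fst z) (fst (snd z)))) \<in> borel_measurable (borel \<Otimes>\<^sub>M borel \<Otimes>\<^sub>M borel)"
      by measurable
    then have "(\<lambda>z. ennreal (1 / \<bar>fst z\<bar>) * f (haar_mat (snd (snd z)) (fst z) (fst (snd z)))) \<in> borel_measurable (lborel \<Otimes>\<^sub>M lborel)"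
      by (simp only: borel_prod lborel_prod measurable_lborel2)
    from lborel.nn_integral_fst[OF this] show ?thesis by simp
  qed
  finally show ?thesis by (simp only: lborel_prod)
qed

text \<open>Uniqueness of Haar measure: integrate \<open>F(g) G(h g)\<close> over \<open>m\<close> in \<open>g\<close> and over \<open>haar\<close> in \<open>h\<close>, then
  substitute \<open>g \<mapsto> h\<inverse> g\<close> and \<open>h \<mapsto> h\<inverse>\<close>.\<close>
lemma haar_unique:
  assumes sets [measurable_cong]: "sets m = sets borel" and "sigma_finite_measure m"
    and SL2: "AE g in m. g \<in> SL2"
    and left: "\<And>h. h \<in> SL2 \<Longrightarrow> distr m borel (\<lambda>g. h ** g) = m"
    and [measurable]: "F \<in> borel_measurable borel" "G \<in> borel_measurable borel"
  shows "(\<integral>\<^sup>+g. F g \<partial>m) * haar G = (\<integral>\<^sup>+g. G g \<partial>m) * haar F"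
proof -
  interpret m: sigma_finite_measure m by fact
  interpret P: pair_sigma_finite m "lborel :: (real \<times> real \<times> real) measure" ..
  define w where "w z = ennreal (1 / \<bar>fst z\<bar>)" for z :: "real \<times> real \<times> real"
  define H where "H z = haar_mat (snd (snd z)) (fst z) (fst (snd z))" for z :: "real \<times> real \<times> real"
  have "w \<in> borel_measurable (borel \<Otimes>\<^sub>M borel \<Otimes>\<^sub>M borel)" "H \<in> borel_measurable (borel \<Otimes>\<^sub>M borel \<Otimes>\<^sub>M borel)"
    unfolding w_def H_def by measurable
  then have [measurable]: "w \<in> borel_measurable borel" "H \<in> borel_measurable borel" by (simp_all only: borel_prod)
  have haar: "haar f = (\<integral>\<^sup>+z. w z * f (H z) \<partial>lborel)" if "f \<in> borel_measurable borel" for f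
    using haar_eq_nn_integral[OF that] by (simp add: w_def H_def)
  \<comment> \<open>Right invariance of \<open>haar\<close> is applied separately for almost every
    \<open>g\<close>, which introduces the product h g.\<close>
  have move: "(\<integral>\<^sup>+g. A g \<partial>m) * haar B = (\<integral>\<^sup>+g. A g * haar (\<lambda>h. B (h ** g)) \<partial>m)"
    if [measurable]: "A \<in> borel_measurable borel" "B \<in> borel_measurable borel" for A B
  proof -
    have "(\<integral>\<^sup>+g. A g \<partial>m) * haar B = (\<integral>\<^sup>+g. A g * haar B \<partial>m)"
      by (rule nn_integral_multc[symmetric]) measurable
    also have "\<dots> = (\<integral>\<^sup>+g. A g * haar (\<lambda>h. B (h ** g)) \<partial>m)"
      by (intro nn_integral_cong_AE eventually_mono[OF SL2]) (simp add: haar_right_invariant)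
    finally show ?thesis .
  qed
  have "(\<integral>\<^sup>+g. F g \<partial>m) * haar G = (\<integral>\<^sup>+g. F g * (\<integral>\<^sup>+z. w z * G (H z ** g) \<partial>lborel) \<partial>m)"
    by (simp add: move) (simp add: haar)
  also have "\<dots> = (\<integral>\<^sup>+g. \<integral>\<^sup>+z. w z * (F g * G (H z ** g)) \<partial>lborel \<partial>m)"
    by (intro nn_integral_cong, subst nn_integral_cmult[symmetric]) (measurable, simp add: ac_simps)
  also have "\<dots> = (\<integral>\<^sup>+z. \<integral>\<^sup>+g. w z * (F g * G (H z ** g)) \<partial>m \<partial>lborel)"
    by (rule P.Fubini'[symmetric]) measurable
  also have "\<dots> = (\<integral>\<^sup>+z. \<integral>\<^sup>+g. w z * (F (adj2 (H z) ** g) * G g) \<partial>m \<partial>lborel)"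
  proof (rule nn_integral_cong)
    fix z :: "real \<times> real \<times> real"
    show "(\<integral>\<^sup>+g. w z * (F g * G (H z ** g)) \<partial>m) = (\<integral>\<^sup>+g. w z * (F (adj2 (H z) ** g) * G g) \<partial>m)"
    \<comment> \<open>At y = 0 the matrix \<open>H z\<close> need not be in \<open>SL2\<close>, but
      the weight is 0 there.\<close>
    proof (cases "fst z = 0")
      case False
      then have h: "H z \<in> SL2" by (simp add: H_def haar_mat_SL2)
      have "(\<integral>\<^sup>+g. w z * (F (adj2 (H z) ** g) * G g) \<partial>m)
        = (\<integral>\<^sup>+g. w z * (F (adj2 (H z) ** g) * G g) \<partial>distr m borel (\<lambda>g. H z ** g))" by (simp add: left[OF h])
      also have "\<dots> = (\<integral>\<^sup>+g. w z * (F g * G (H z ** g)) \<partial>m)"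
        by (subst nn_integral_distr) (measurable, simp add: adj2_cancel[OF h])
      finally show ?thesis by simp
    qed (simp add: w_def)
  qed
  also have "\<dots> = (\<integral>\<^sup>+g. \<integral>\<^sup>+z. w z * (F (adj2 (H z) ** g) * G g) \<partial>lborel \<partial>m)"
    by (rule P.Fubini') measurable
  also have "\<dots> = (\<integral>\<^sup>+g. G g * (\<integral>\<^sup>+z. w z * F (adj2 (H z) ** g) \<partial>lborel) \<partial>m)"
    by (intro nn_integral_cong, subst nn_integral_cmult[symmetric]) (measurable, simp add: ac_simps)
  also have "\<dots> = (\<integral>\<^sup>+g. G g * haar (\<lambda>h. F (adj2 h ** g)) \<partial>m)"
    by (simp add: haar)
  also have "\<dots> = (\<integral>\<^sup>+g. G g * haar (\<lambda>h. F (h ** g)) \<partial>m)"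
    by (intro nn_integral_cong arg_cong[of _ _ "\<lambda>x. _ * x"] haar_adj2) measurable
  also have "\<dots> = (\<integral>\<^sup>+g. G g \<partial>m) * haar F" by (simp add: move)
  finally show ?thesis .
qed

section \<open>The Haar measure of the sets of lowest bases\<close>

lemma haar_mat_lowest_bases_iff:
  assumes s: "0 < s" and y: "0 < y"
  shows "haar_mat (s * x) y (y * t) \<in> lowest_bases s b \<longleftrightarrow>
    s * b \<le> s * y \<and> \<bar>x\<bar> < 1 \<and> 0 \<le> t \<and> t < 1 \<and> s * y * (1 + x * t) \<le> 1 \<and> s * y * (1 + x * (t - 1)) \<le> 1"
proof -
  have 1: "\<bar>s * x\<bar> < s \<longleftrightarrow> \<bar>x\<bar> < 1" using s by (simp add: abs_mult)
  have 2: "b \<le> y \<longleftrightarrow> s * b \<le> s * y" using s by simp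
  have 3: "0 \<le> y * t \<longleftrightarrow> 0 \<le> t" "y * t < y \<longleftrightarrow> t < 1" using y by (simp_all add: zero_le_mult_iff)
  have 4: "(s * x * (y * t) - 1) / y \<le> - s \<longleftrightarrow> s * y * (1 + x * t) \<le> 1"
    using y by (simp add: pos_divide_le_eq algebra_simps)
  have "(s * x * (y * t) - 1) / y - s * x \<le> - s \<longleftrightarrow> (s * x * (y * t) - 1) / y \<le> s * x - s" by linarith
  also have "\<dots> \<longleftrightarrow> s * x * (y * t) - 1 \<le> (s * x - s) * y" using y by (rule pos_divide_le_eq)
  also have "\<dots> \<longleftrightarrow> s * y * (1 + x * (t - 1)) \<le> 1" by (simp add: algebra_simps)
  finally show ?thesis
    using y haar_mat_SL2[of y "s * x" "y * t"] unfolding lowest_bases_def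
    by (auto simp: haar_mat_def 1 2 3 4)
qed

text \<open>The substitution \<open>x \<mapsto> s x\<close>, \<open>q \<mapsto> y t\<close>, \<open>y \<mapsto> y / s\<close> removes the density \<open>1 / \<bar>y\<bar>\<close>; the halves
  \<open>x > 0\<close> and \<open>x < 0\<close> are exchanged by \<open>(t, x) \<mapsto> (1 - t, - x)\<close>.\<close>
lemma haar_lowest_bases:
  assumes s: "0 < s" and b: "0 \<le> b"
  shows "haar (indicator (lowest_bases s b)) =
    2 * (\<integral>\<^sup>+t. \<integral>\<^sup>+x. indicator {0..1} t * (indicator {0..1} x * ennreal (1 / (1 + x * t) - s * b)) \<partial>lborel \<partial>lborel)"
proof -
  define \<psi> :: "real \<Rightarrow> real \<Rightarrow> real \<Rightarrow> ennreal" where "\<psi> y t x =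
    (if 0 < y \<and> s * b \<le> y \<and> \<bar>x\<bar> < 1 \<and> 0 \<le> t \<and> t < 1 \<and> y * (1 + x * t) \<le> 1 \<and> y * (1 + x * (t - 1)) \<le> 1 then 1 else 0)" for y t x
  define \<psi>1 :: "real \<Rightarrow> real \<Rightarrow> real \<Rightarrow> ennreal" where "\<psi>1 y t x =
    (if 0 < y \<and> s * b \<le> y \<and> 0 \<le> x \<and> x < 1 \<and> 0 \<le> t \<and> t < 1 \<and> y * (1 + x * t) \<le> 1 then 1 else 0)" for y t x
  define \<psi>2 :: "real \<Rightarrow> real \<Rightarrow> real \<Rightarrow> ennreal" where "\<psi>2 y t x =
    (if 0 < y \<and> s * b \<le> y \<and> -1 < x \<and> x < 0 \<and> 0 \<le> t \<and> t < 1 \<and> y * (1 + x * (t - 1)) \<le> 1 then 1 else 0)" for y t x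
  define \<phi> :: "real \<Rightarrow> real \<Rightarrow> real \<Rightarrow> ennreal" where "\<phi> y t x =
    (if 0 < y \<and> s * b \<le> y \<and> 0 \<le> x \<and> x \<le> 1 \<and> 0 \<le> t \<and> t \<le> 1 \<and> y * (1 + x * t) \<le> 1 then 1 else 0)" for y t x
  have [measurable (raw)]: "(\<lambda>x. \<psi> (u x) (v x) (w x)) \<in> borel_measurable N"
    "(\<lambda>x. \<psi>1 (u x) (v x) (w x)) \<in> borel_measurable N"
    "(\<lambda>x. \<psi>2 (u x) (v x) (w x)) \<in> borel_measurable N"
    "(\<lambda>x. \<phi> (u x) (v x) (w x)) \<in> borel_measurable N"
    if [measurable]: "u \<in> borel_measurable N" "v \<in> borel_measurable N" "w \<in> borel_measurable N"
    for u v w and N :: "'z measure"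
    unfolding \<psi>_def \<psi>1_def \<psi>2_def \<phi>_def by measurable
  \<comment> \<open>The summand 0 keeps the affine shape t + c x of
    \<open>nn_integral_real_affine\<close>.\<close>
  have scale: "(\<integral>\<^sup>+q. \<integral>\<^sup>+x. ennreal (1 / \<bar>y\<bar>) * indicator (lowest_bases s b) (haar_mat x y q) \<partial>lborel \<partial>lborel)
    = ennreal s * (\<integral>\<^sup>+t. \<integral>\<^sup>+x. \<psi> (0 + s * y) t x \<partial>lborel \<partial>lborel)" for y
  proof (cases "0 < y")
    case False
    then have z1: "ennreal (1 / \<bar>y\<bar>) * indicator (lowest_bases s b) (haar_mat x y q) = 0" for x q
      by (simp add: lowest_bases_def haar_mat_def indicator_def)
    have z2: "\<psi> (0 + s * y) t x = 0" for t x
      using False s by (simp add: \<psi>_def zero_less_mult_iff)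
    show ?thesis unfolding z1 z2 by simp
  next
    case y: True
    define k where "k q x = ennreal (1 / \<bar>y\<bar>) * indicator (lowest_bases s b) (haar_mat x y q)" for q x
    have [measurable]: "case_prod k \<in> borel_measurable (borel \<Otimes>\<^sub>M borel)"
      unfolding k_def by measurable
    have k\<psi>: "k (0 + y * t) (0 + s * x) = ennreal (1 / y) * \<psi> (0 + s * y) t x" for t x
      using haar_mat_lowest_bases_iff[OF s y, of x t b] s y by (auto simp: k_def \<psi>_def)
    have "(\<integral>\<^sup>+q. \<integral>\<^sup>+x. k q x \<partial>lborel \<partial>lborel) = \<bar>y\<bar> * (\<integral>\<^sup>+t. \<integral>\<^sup>+x. k (0 + y * t) x \<partial>lborel \<partial>lborel)"
      using y by (intro nn_integral_real_affine) (measurable, (simp_all)?)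
    also have "(\<integral>\<^sup>+t. \<integral>\<^sup>+x. k (0 + y * t) x \<partial>lborel \<partial>lborel)
      = (\<integral>\<^sup>+t. \<bar>s\<bar> * (\<integral>\<^sup>+x. k (0 + y * t) (0 + s * x) \<partial>lborel) \<partial>lborel)"
      using s by (intro nn_integral_cong, intro nn_integral_real_affine) (measurable, (simp_all)?)
    also have "\<dots> = \<bar>s\<bar> * (\<integral>\<^sup>+t. \<integral>\<^sup>+x. k (0 + y * t) (0 + s * x) \<partial>lborel \<partial>lborel)"
      by (intro nn_integral_cmult) measurable
    also have "(\<integral>\<^sup>+t. \<integral>\<^sup>+x. k (0 + y * t) (0 + s * x) \<partial>lborel \<partial>lborel)
      = (\<integral>\<^sup>+t. ennreal (1 / y) * (\<integral>\<^sup>+x. \<psi> (0 + s * y) t x \<partial>lborel) \<partial>lborel)"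
      unfolding k\<psi> by (intro nn_integral_cong nn_integral_cmult) measurable
    also have "\<dots> = ennreal (1 / y) * (\<integral>\<^sup>+t. \<integral>\<^sup>+x. \<psi> (0 + s * y) t x \<partial>lborel \<partial>lborel)"
      by (intro nn_integral_cmult) measurable
    finally have "(\<integral>\<^sup>+q. \<integral>\<^sup>+x. k q x \<partial>lborel \<partial>lborel)
      = (ennreal y * ennreal (1 / y)) * (ennreal s * (\<integral>\<^sup>+t. \<integral>\<^sup>+x. \<psi> (0 + s * y) t x \<partial>lborel \<partial>lborel))"
      using s y by (simp add: ac_simps)
    moreover have "ennreal y * ennreal (1 / y) = 1" using y by (simp add: ennreal_mult[symmetric])
    ultimately show ?thesis by (simp add: k_def)
  qed
  have "haar (indicator (lowest_bases s b)) = (\<integral>\<^sup>+y. ennreal s * (\<integral>\<^sup>+t. \<integral>\<^sup>+x. \<psi> (0 + s * y) t x \<partial>lborel \<partial>lborel) \<partial>lborel)"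
    unfolding haar_def scale ..
  also have "\<dots> = ennreal \<bar>s\<bar> * (\<integral>\<^sup>+y. \<integral>\<^sup>+t. \<integral>\<^sup>+x. \<psi> (0 + s * y) t x \<partial>lborel \<partial>lborel \<partial>lborel)"
    using s by (subst nn_integral_cmult) (measurable, (simp_all)?)
  also have "\<dots> = (\<integral>\<^sup>+y. \<integral>\<^sup>+t. \<integral>\<^sup>+x. \<psi> y t x \<partial>lborel \<partial>lborel \<partial>lborel)"
    using s by (intro nn_integral_real_affine[symmetric]) (measurable, (simp_all)?)
  also have "\<dots> = (\<integral>\<^sup>+y. 2 * (\<integral>\<^sup>+t. \<integral>\<^sup>+x. \<phi> y t x \<partial>lborel \<partial>lborel) \<partial>lborel)"
  proof (rule nn_integral_cong)
    fix y
    have split: "\<psi> y t x = \<psi>1 y t x + \<psi>2 y t x" for t x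
    proof (cases "0 < y \<and> \<bar>x\<bar> < 1 \<and> 0 \<le> t \<and> t < 1")
      case True
      \<comment> \<open>Since x (t - 1) and x t differ by x, the sign of x decides which of the two
        inequalities implies the other.\<close>
      define P Q where "P \<longleftrightarrow> y * (1 + x * t) \<le> 1" and "Q \<longleftrightarrow> y * (1 + x * (t - 1)) \<le> 1"
      have "x \<ge> 0 \<Longrightarrow> P \<Longrightarrow> Q" unfolding P_def Q_def
        using True by (elim order_trans[rotated] mult_left_mono) (auto intro!: mult_left_mono)
      moreover have "x < 0 \<Longrightarrow> Q \<Longrightarrow> P" unfolding P_def Q_def
        using True by (elim order_trans[rotated] mult_left_mono) (auto intro!: mult_left_mono_neg)
      ultimately show ?thesis using True unfolding \<psi>_def \<psi>1_def \<psi>2_def P_def[symmetric] Q_def[symmetric]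
        by (cases "x \<ge> 0") auto
    qed (auto simp: \<psi>_def \<psi>1_def \<psi>2_def)
    have 1: "(\<integral>\<^sup>+t. \<integral>\<^sup>+x. \<psi>1 y t x \<partial>lborel \<partial>lborel) = (\<integral>\<^sup>+t. \<integral>\<^sup>+x. \<phi> y t x \<partial>lborel \<partial>lborel)"
    proof (rule nn_integral_cong_AE, rule eventually_mono[OF AE_lborel_singleton[of 1]])
      fix t :: real assume t: "t \<noteq> 1"
      show "(\<integral>\<^sup>+x. \<psi>1 y t x \<partial>lborel) = (\<integral>\<^sup>+x. \<phi> y t x \<partial>lborel)"
        by (rule nn_integral_cong_AE, rule eventually_mono[OF AE_lborel_singleton[of 1]])
          (use t in \<open>auto simp: \<psi>1_def \<phi>_def\<close>)
    qed
    have "(\<integral>\<^sup>+t. \<integral>\<^sup>+x. \<psi>2 y t x \<partial>lborel \<partial>lborel) = (\<integral>\<^sup>+t. \<integral>\<^sup>+x. \<psi>2 y (1 + (-1) * t) x \<partial>lborel \<partial>lborel)"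
      by (subst nn_integral_real_affine[where c = "-1" and t = 1]) (measurable, (simp_all)?)
    also have "\<dots> = (\<integral>\<^sup>+t. \<integral>\<^sup>+x. \<psi>2 y (1 - t) (- x) \<partial>lborel \<partial>lborel)"
      by (rule nn_integral_cong, subst nn_integral_reflect[symmetric]) (measurable, (simp_all)?)
    also have "\<dots> = (\<integral>\<^sup>+t. \<integral>\<^sup>+x. \<phi> y t x \<partial>lborel \<partial>lborel)"
    proof (rule nn_integral_cong_AE, rule eventually_mono[OF AE_lborel_singleton[of 0]])
      fix t :: real assume t: "t \<noteq> 0"
      have "AE x in lborel. x \<noteq> (0::real) \<and> x \<noteq> 1"
        using AE_lborel_singleton[of 0] AE_lborel_singleton[of 1] by eventually_elim simp
      then show "(\<integral>\<^sup>+x. \<psi>2 y (1 - t) (- x) \<partial>lborel) = (\<integral>\<^sup>+x. \<phi> y t x \<partial>lborel)"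
        by (intro nn_integral_cong_AE, elim eventually_mono)
          (use t in \<open>auto simp: \<psi>2_def \<phi>_def algebra_simps\<close>)
    qed
    finally have 2: "(\<integral>\<^sup>+t. \<integral>\<^sup>+x. \<psi>2 y t x \<partial>lborel \<partial>lborel) = (\<integral>\<^sup>+t. \<integral>\<^sup>+x. \<phi> y t x \<partial>lborel \<partial>lborel)" .
    have "(\<integral>\<^sup>+t. \<integral>\<^sup>+x. \<psi> y t x \<partial>lborel \<partial>lborel) = (\<integral>\<^sup>+t. (\<integral>\<^sup>+x. \<psi>1 y t x \<partial>lborel) + (\<integral>\<^sup>+x. \<psi>2 y t x \<partial>lborel) \<partial>lborel)"
      unfolding split by (intro nn_integral_cong nn_integral_add) measurable
    also have "\<dots> = (\<integral>\<^sup>+t. \<integral>\<^sup>+x. \<psi>1 y t x \<partial>lborel \<partial>lborel) + (\<integral>\<^sup>+t. \<integral>\<^sup>+x. \<psi>2 y t x \<partial>lborel \<partial>lborel)"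
      by (intro nn_integral_add) measurable
    finally show "(\<integral>\<^sup>+t. \<integral>\<^sup>+x. \<psi> y t x \<partial>lborel \<partial>lborel) = 2 * (\<integral>\<^sup>+t. \<integral>\<^sup>+x. \<phi> y t x \<partial>lborel \<partial>lborel)"
      by (simp add: 1 2 mult_2)
  qed
  also have "\<dots> = 2 * (\<integral>\<^sup>+y. \<integral>\<^sup>+t. \<integral>\<^sup>+x. \<phi> y t x \<partial>lborel \<partial>lborel \<partial>lborel)"
    by (intro nn_integral_cmult) measurable
  also have "(\<integral>\<^sup>+y. \<integral>\<^sup>+t. \<integral>\<^sup>+x. \<phi> y t x \<partial>lborel \<partial>lborel \<partial>lborel) = (\<integral>\<^sup>+t. \<integral>\<^sup>+y. \<integral>\<^sup>+x. \<phi> y t x \<partial>lborel \<partial>lborel \<partial>lborel)"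
    by (rule lborel_pair.Fubini') measurable
  also have "\<dots> = (\<integral>\<^sup>+t. \<integral>\<^sup>+x. \<integral>\<^sup>+y. \<phi> y t x \<partial>lborel \<partial>lborel \<partial>lborel)"
    by (rule nn_integral_cong, rule lborel_pair.Fubini') measurable
  also have "\<dots> = (\<integral>\<^sup>+t. \<integral>\<^sup>+x. indicator {0..1} t * (indicator {0..1} x * ennreal (1 / (1 + x * t) - s * b)) \<partial>lborel \<partial>lborel)"
  proof (rule nn_integral_cong, rule nn_integral_cong)
    fix t x :: real
    show "(\<integral>\<^sup>+y. \<phi> y t x \<partial>lborel) = indicator {0..1} t * (indicator {0..1} x * ennreal (1 / (1 + x * t) - s * b))"
    proof (cases "t \<in> {0..1} \<and> x \<in> {0..1}")
      case True
      then have "0 \<le> x * t" by auto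
      then have "y * (1 + x * t) \<le> 1 \<longleftrightarrow> y \<le> 1 / (1 + x * t)" for y by (simp add: pos_le_divide_eq)
      then have "\<phi> y t x = (if 0 < y \<and> s * b \<le> y \<and> y \<le> 1 / (1 + x * t) then 1 else 0)" for y
        using True by (simp add: \<phi>_def)
      \<comment> \<open>The integrands differ at most at y = 0. If s b exceeds the upper end the
        interval is empty, and \<open>ennreal\<close> clips the negative length to 0.\<close>
      then have "(\<integral>\<^sup>+y. \<phi> y t x \<partial>lborel) = (\<integral>\<^sup>+y. indicator {s * b..1 / (1 + x * t)} y \<partial>lborel)"
        using s b by (intro nn_integral_cong_AE eventually_mono[OF AE_lborel_singleton[of 0]])
          (auto simp: indicator_def less_le intro: order_trans[OF mult_nonneg_nonneg])
      also have "\<dots> = ennreal (1 / (1 + x * t) - s * b)"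
        by (simp add: emeasure_lborel_Icc_eq ennreal_neg)
      finally show ?thesis using True by simp
    next
      case False
      then have "\<phi> y t x = 0" for y by (auto simp: \<phi>_def)
      moreover have "indicator {0..1} t * (indicator {0..1} x * ennreal (1 / (1 + x * t) - s * b)) = 0"
        using False by (auto simp: indicator_def)
      ultimately show ?thesis by simp
    qed
  qed
  finally show ?thesis .
qed

section \<open>Explicit integrals\<close>

text \<open>Even terms make up a quarter of zeta(2); removing them twice leaves half of it.\<close>

lemma alternating_squares_sums:
  "(\<lambda>k. 1 / (2 * real k + 1)\<^sup>2 - 1 / (2 * real k + 2)\<^sup>2) sums (pi\<^sup>2 / 12)"
proof -
  have S: "(\<lambda>n. 1 / (real n + 1)\<^sup>2) sums (pi\<^sup>2 / 6)"
    using inverse_squares_sums by (simp add: add.commute)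
  have "{n * 2..<n * 2 + 2} = {2 * n, 2 * n + 1}" for n :: nat by auto
  then have "(\<lambda>k. 1 / (2 * real k + 1)\<^sup>2 + 1 / (2 * real k + 2)\<^sup>2) sums (pi\<^sup>2 / 6)"
    using sums_group[OF S, of 2] by (simp add: algebra_simps)
  moreover have "(\<lambda>k. 1/2 * (1 / (real k + 1)\<^sup>2)) sums (1/2 * (pi\<^sup>2 / 6))"
    using S by (rule sums_mult)
  ultimately have "(\<lambda>k. (1 / (2 * real k + 1)\<^sup>2 + 1 / (2 * real k + 2)\<^sup>2) - 1/2 * (1 / (real k + 1)\<^sup>2))
    sums (pi\<^sup>2 / 6 - 1/2 * (pi\<^sup>2 / 6))" by (rule sums_diff)
  moreover have "1/2 * (1 / (real k + 1)\<^sup>2) = 2 * (1 / (2 * real k + 2)\<^sup>2)" for k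
  proof -
    have "(2 * real k + 2)\<^sup>2 = 4 * (real k + 1)\<^sup>2" by (simp add: power2_eq_square algebra_simps)
    then show ?thesis by simp
  qed
  ultimately show ?thesis by simp
qed

text \<open>The condition \<open>d \<le> c\<close> keeps the integrand nonnegative on the unit
  interval. It serves both variables of the double integral below: powers of t as coefficients
  inside, reciprocals of integers outside.\<close>

lemma nn_integral_unit_powers:
  fixes c d :: real
  assumes "0 \<le> d" "d \<le> c"
  shows "(\<integral>\<^sup>+x. ennreal (c * x ^ n - d * x ^ Suc n) * indicator {0..1} x \<partial>lborel)
    = ennreal (c / (real n + 1) - d / (real n + 2))"
proof -
  define F where "F x = c * x ^ Suc n / (real n + 1) - d * x ^ Suc (Suc n) / (real n + 2)" for x :: real
  have "(\<integral>\<^sup>+x. ennreal (c * x ^ n - d * x ^ Suc n) * indicator {0..1} x \<partial>lborel) = ennreal (F 1 - F 0)"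
  proof (rule nn_integral_FTC_Icc)
    fix x :: real assume x: "x \<in> {0..1}"
    have "((\<lambda>x. c * x ^ Suc n / (real n + 1) - d * x ^ Suc (Suc n) / (real n + 2)) has_real_derivative
      c * (real (Suc n) * x ^ n) / (real n + 1) - d * (real (Suc (Suc n)) * x ^ Suc n) / (real n + 2)) (at x)"
      by (intro derivative_intros DERIV_cdivide DERIV_cmult DERIV_pow[THEN DERIV_cong]) auto
    moreover have "c * (real (Suc n) * x ^ n) / (real n + 1) = c * x ^ n"
      "d * (real (Suc (Suc n)) * x ^ Suc n) / (real n + 2) = d * x ^ Suc n"
      by (simp_all add: field_simps)
    ultimately show "(F has_real_derivative c * x ^ n - d * x ^ Suc n) (at x)" unfolding F_def by simp
    have "x ^ Suc n \<le> x ^ n" using x by (simp add: power_decreasing mult_left_le_one_le)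
    then have "d * x ^ Suc n \<le> c * x ^ n" using assms x by (intro mult_mono) auto
    then show "0 \<le> c * x ^ n - d * x ^ Suc n" by simp
  qed auto
  then show ?thesis by (simp add: F_def)
qed

text \<open>The geometric series in -u with consecutive terms paired, so that all summands are
  nonnegative and may be integrated termwise in \<open>ennreal\<close>.\<close>

lemma inverse_one_plus_sums:
  assumes "0 \<le> u" "u < (1::real)"
  shows "ennreal (1 / (1 + u)) = (\<Sum>k. ennreal (u ^ (2 * k) - u ^ Suc (2 * k)))"
proof -
  have "u\<^sup>2 < 1" using assms by (simp add: power_less_one_iff)
  then have "(\<lambda>k. (1 - u) * (u\<^sup>2) ^ k) sums ((1 - u) * (1 / (1 - u\<^sup>2)))"
    using assms by (intro sums_mult geometric_sums) simp
  moreover have "(1 - u) * (1 / (1 - u\<^sup>2)) = 1 / (1 + u)"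
  proof -
    have "1 - u\<^sup>2 = (1 - u) * (1 + u)" by (simp add: power2_eq_square algebra_simps)
    then show ?thesis using assms by simp
  qed
  ultimately have s: "(\<lambda>k. u ^ (2 * k) - u ^ Suc (2 * k)) sums (1 / (1 + u))"
    by (simp add: power_mult[symmetric] algebra_simps)
  have "0 \<le> u ^ (2 * k) - u ^ Suc (2 * k)" for k
    using assms by (simp add: mult_left_le_one_le)
  then show ?thesis using s by (simp add: suminf_ennreal2 sums_iff del: power_Suc)
qed

lemma nn_integral_inverse_one_plus:
  "(\<integral>\<^sup>+t. \<integral>\<^sup>+x. indicator {0..1} t * (indicator {0..1} x * ennreal (1 / (1 + x * t))) \<partial>lborel \<partial>lborel) = ennreal (pi\<^sup>2 / 12)"
proof -
  define T where "T k t x = indicator {0..1} t * (indicator {0..1} x * ennreal ((x * t) ^ (2 * k) - (x * t) ^ Suc (2 * k)))"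
    for k :: nat and t x :: real
  have [measurable]: "(\<lambda>(t, x). T k t x) \<in> borel_measurable (borel \<Otimes>\<^sub>M borel)" for k
    unfolding T_def by measurable
  have Tx: "(\<integral>\<^sup>+x. T k t x \<partial>lborel) = ennreal (1 / (2 * real k + 1) * t ^ (2 * k) - 1 / (2 * real k + 2) * t ^ Suc (2 * k)) * indicator {0..1} t" for k t
  proof (cases "t \<in> {0..1}")
    case True
    then have "t ^ Suc (2 * k) \<le> t ^ (2 * k)" "0 \<le> t ^ Suc (2 * k)" by (simp_all add: mult_left_le_one_le)
    from nn_integral_unit_powers[OF this(2,1), of "2 * k"]
    have "(\<integral>\<^sup>+x. ennreal (t ^ (2 * k) * x ^ (2 * k) - t ^ Suc (2 * k) * x ^ Suc (2 * k)) * indicator {0..1} x \<partial>lborel)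
      = ennreal (t ^ (2 * k) / (2 * real k + 1) - t ^ Suc (2 * k) / (2 * real k + 2))" by simp
    then show ?thesis using True by (simp add: T_def power_mult_distrib mult.commute mult.left_commute mult.assoc)
  qed (simp add: T_def)
  have T: "(\<integral>\<^sup>+t. \<integral>\<^sup>+x. T k t x \<partial>lborel \<partial>lborel) = ennreal (1 / (2 * real k + 1)\<^sup>2 - 1 / (2 * real k + 2)\<^sup>2)" for k
  proof -
    have "0 \<le> 1 / (2 * real k + 2)" "1 / (2 * real k + 2) \<le> 1 / (2 * real k + 1)" by (auto simp: field_simps)
    from nn_integral_unit_powers[OF this, of "2 * k"] show ?thesis
      unfolding Tx by (simp add: power2_eq_square)
  qed
  have "(\<integral>\<^sup>+t. \<integral>\<^sup>+x. indicator {0..1} t * (indicator {0..1} x * ennreal (1 / (1 + x * t))) \<partial>lborel \<partial>lborel)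
    = (\<integral>\<^sup>+t. \<integral>\<^sup>+x. (\<Sum>k. T k t x) \<partial>lborel \<partial>lborel)"
  \<comment> \<open>At x = t = 1 all paired terms vanish while the left side is 1/2, so the null set
    t = 1 is discarded.\<close>
  proof (rule nn_integral_cong_AE, rule eventually_mono[OF AE_lborel_singleton[of 1]], rule nn_integral_cong)
    fix t x :: real assume t: "t \<noteq> 1"
    show "indicator {0..1} t * (indicator {0..1} x * ennreal (1 / (1 + x * t))) = (\<Sum>k. T k t x)"
    proof (cases "t \<in> {0..1} \<and> x \<in> {0..1}")
      case True
      then have "x * t \<le> 1 * t" by (intro mult_right_mono) auto
      then have "0 \<le> x * t" "x * t < 1" using True t by auto
      from inverse_one_plus_sums[OF this] show ?thesis using True by (simp add: T_def)
    qed (auto simp: T_def indicator_def)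
  qed
  also have "\<dots> = (\<integral>\<^sup>+t. (\<Sum>k. \<integral>\<^sup>+x. T k t x \<partial>lborel) \<partial>lborel)"
    by (rule nn_integral_cong, rule nn_integral_suminf) measurable
  also have "\<dots> = (\<Sum>k. \<integral>\<^sup>+t. \<integral>\<^sup>+x. T k t x \<partial>lborel \<partial>lborel)"
    by (rule nn_integral_suminf) measurable
  also have "\<dots> = ennreal (pi\<^sup>2 / 12)"
  proof -
    have "0 \<le> 1 / (2 * real k + 1)\<^sup>2 - 1 / (2 * real k + 2)\<^sup>2" for k
      by (simp add: frac_le power_mono)
    then show ?thesis unfolding T by (rule suminf_ennreal_eq[OF _ alternating_squares_sums])
  qed
  finally show ?thesis .
qed

text \<open>For t < \<epsilon> every x in [0, 1] contributes, which gives the 3/4. For t >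
  \<epsilon> only x \<le> \<epsilon> / t does; the inner integral is then \<epsilon>^2 / (2 t), and
  its integral over [\<epsilon>, 1] is the logarithm.\<close>

lemma nn_integral_hyperbola:
  fixes \<epsilon> :: real
  assumes e: "0 < \<epsilon>" "\<epsilon> < 1"
  shows "(\<integral>\<^sup>+t. \<integral>\<^sup>+x. indicator {0..1} t * (indicator {0..1} x * ennreal (\<epsilon> - x * t)) \<partial>lborel \<partial>lborel)
    = ennreal (3/4 * \<epsilon>\<^sup>2 + \<epsilon>\<^sup>2 / 2 * ln (1 / \<epsilon>))"
proof -
  have inner: "(\<integral>\<^sup>+x. indicator {0..1} t * (indicator {0..1} x * ennreal (\<epsilon> - x * t)) \<partial>lborel)
    = ennreal (\<epsilon> - t / 2) * indicator {0..\<epsilon>} t + ennreal (\<epsilon>\<^sup>2 / 2 * (1 / t)) * indicator {\<epsilon>..1} t" if t: "t \<noteq> \<epsilon>" for t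
  proof -
    have der: "((\<lambda>x. \<epsilon> * x - t * x\<^sup>2 / 2) has_real_derivative \<epsilon> - x * t) (at x)" for x
      by (auto intro!: derivative_eq_intros)
    consider "t \<notin> {0..1}" | "0 \<le> t" "t < \<epsilon>" | "\<epsilon> < t" "t \<le> 1" using t by fastforce
    then show ?thesis
    proof cases
      case 1
      then show ?thesis using e by (auto simp: indicator_def)
    next
      case 2
      have "x * t \<le> 1 * t" if "x \<in> {0..1}" for x using that 2 by (intro mult_right_mono) auto
      then have "(\<integral>\<^sup>+x. ennreal (\<epsilon> - x * t) * indicator {0..1} x \<partial>lborel) = ennreal ((\<epsilon> * 1 - t * 1\<^sup>2 / 2) - (\<epsilon> * 0 - t * 0\<^sup>2 / 2))"
        using 2 by (intro nn_integral_FTC_Icc der) force+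
      then show ?thesis using 2 e by (simp add: mult.commute)
    next
      case 3
      have t0: "t > 0" using 3 e by simp
      have le: "x * t \<le> \<epsilon> \<longleftrightarrow> x \<le> \<epsilon> / t" for x using t0 by (simp add: pos_le_divide_eq)
      have "indicator {0..1} x * ennreal (\<epsilon> - x * t) = ennreal (\<epsilon> - x * t) * indicator {0..\<epsilon> / t} x" for x
      proof -
        have "\<epsilon> / t \<le> 1" using 3 t0 by simp
        then show ?thesis using le[of x] by (auto simp: indicator_def ennreal_neg)
      qed
      then have "(\<integral>\<^sup>+x. indicator {0..1} x * ennreal (\<epsilon> - x * t) \<partial>lborel)
        = (\<integral>\<^sup>+x. ennreal (\<epsilon> - x * t) * indicator {0..\<epsilon> / t} x \<partial>lborel)" by simp
      also have "\<dots> = ennreal ((\<epsilon> * (\<epsilon> / t) - t * (\<epsilon> / t)\<^sup>2 / 2) - (\<epsilon> * 0 - t * 0\<^sup>2 / 2))"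
        using le t0 e by (intro nn_integral_FTC_Icc der) auto
      also have "(\<epsilon> * (\<epsilon> / t) - t * (\<epsilon> / t)\<^sup>2 / 2) - (\<epsilon> * 0 - t * 0\<^sup>2 / 2) = \<epsilon>\<^sup>2 / 2 * (1 / t)"
        using t0 by (simp add: field_simps power2_eq_square)
      finally show ?thesis using 3 e by simp
    qed
  qed
  have "(\<integral>\<^sup>+t. \<integral>\<^sup>+x. indicator {0..1} t * (indicator {0..1} x * ennreal (\<epsilon> - x * t)) \<partial>lborel \<partial>lborel)
    = (\<integral>\<^sup>+t. ennreal (\<epsilon> - t / 2) * indicator {0..\<epsilon>} t + ennreal (\<epsilon>\<^sup>2 / 2 * (1 / t)) * indicator {\<epsilon>..1} t \<partial>lborel)"
    by (intro nn_integral_cong_AE eventually_mono[OF AE_lborel_singleton[of \<epsilon>]] inner)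
  also have "\<dots> = (\<integral>\<^sup>+t. ennreal (\<epsilon> - t / 2) * indicator {0..\<epsilon>} t \<partial>lborel)
      + (\<integral>\<^sup>+t. ennreal (\<epsilon>\<^sup>2 / 2 * (1 / t)) * indicator {\<epsilon>..1} t \<partial>lborel)"
    by (intro nn_integral_add) measurable
  also have "(\<integral>\<^sup>+t. ennreal (\<epsilon> - t / 2) * indicator {0..\<epsilon>} t \<partial>lborel) = ennreal ((\<epsilon> * \<epsilon> - \<epsilon>\<^sup>2 / 4) - (\<epsilon> * 0 - 0\<^sup>2 / 4))"
    using e by (intro nn_integral_FTC_Icc) (auto intro!: derivative_eq_intros)
  also have "(\<integral>\<^sup>+t. ennreal (\<epsilon>\<^sup>2 / 2 * (1 / t)) * indicator {\<epsilon>..1} t \<partial>lborel) = ennreal (\<epsilon>\<^sup>2 / 2 * ln 1 - \<epsilon>\<^sup>2 / 2 * ln \<epsilon>)"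
    using e by (intro nn_integral_FTC_Icc) (auto intro!: derivative_eq_intros)
  also have "ennreal ((\<epsilon> * \<epsilon> - \<epsilon>\<^sup>2 / 4) - (\<epsilon> * 0 - 0\<^sup>2 / 4)) + ennreal (\<epsilon>\<^sup>2 / 2 * ln 1 - \<epsilon>\<^sup>2 / 2 * ln \<epsilon>)
    = ennreal (3/4 * \<epsilon>\<^sup>2 + \<epsilon>\<^sup>2 / 2 * ln (1 / \<epsilon>))"
    using e by (subst ennreal_plus[symmetric])
      (auto simp: ln_div power2_eq_square mult_nonneg_nonpos intro!: arg_cong[where f = ennreal])
  finally show ?thesis .
qed

section \<open>The measure of the sets K\<close>

text \<open>A nonzero vector has an integer coefficient of absolute value at least 1, which Cramer's
  rule bounds by a multiple of the norm.\<close>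

lemma lat_supnorm_lower_bound:
  assumes g: "g \<in> SL2"
  obtains \<delta> where "0 < \<delta>" "\<forall>v \<in> lat g - {0}. \<delta> \<le> supnorm v"
proof -
  obtain A where A: "A > 0" "\<And>i j. \<bar>g$i$j\<bar> \<le> A" using entries_bounded[of g] by auto
  show thesis
  proof (rule that[of "1 / (2 * A)"], goal_cases)
    case 1
    show ?case using A by simp
  next
    case 2
    show ?case
    proof
    fix v assume v: "v \<in> lat g - {0}"
    then obtain m n :: int where mn: "v$1 = of_int m * g$1$1 + of_int n * g$1$2"
      "v$2 = of_int m * g$2$1 + of_int n * g$2$2" by (auto simp: lat_iff)
    have "m \<noteq> 0 \<or> n \<noteq> 0" using v mn by (auto simp: vec2_eq_iff)
    then have "1 \<le> \<bar>real_of_int m\<bar> \<or> 1 \<le> \<bar>real_of_int n\<bar>" by linarith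
    then have "1 \<le> 2 * A * supnorm v" using SL2_coeff_bound[OF g mn order_refl A(2)] by linarith
    then show "1 / (2 * A) \<le> supnorm v" using A by (simp add: pos_divide_le_eq mult.commute)
    qed
  qed
qed

lemma ln_inverse_supnorm_le_iff: "v \<noteq> 0 \<Longrightarrow> ln (1 / supnorm v) \<le> r \<longleftrightarrow> exp (- r) \<le> supnorm v"
  using supnorm_pos[of v] ln_ge_iff[of "supnorm v" "- r"] by (auto simp: ln_div)

text \<open>\<open>Delta\<close> is a supremum of reals, so the rules for comparing it with a number
  require this bound.\<close>

lemma Delta_bdd_above:
  assumes g: "g \<in> SL2"
  shows "bdd_above ((\<lambda>v. ln (1 / supnorm v)) ` (lat g - {0}))"
proof -
  obtain \<delta> where d: "0 < \<delta>" "\<forall>v \<in> lat g - {0}. \<delta> \<le> supnorm v" using lat_supnorm_lower_bound[OF g] .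
  have "ln (1 / supnorm v) \<le> - ln \<delta>" if "v \<in> lat g - {0}" for v
    using that d by (subst ln_inverse_supnorm_le_iff) auto
  then show ?thesis by (rule bdd_aboveI2)
qed

lemma Delta_le_iff:
  assumes g: "g \<in> SL2"
  shows "Delta (lat g) \<le> r \<longleftrightarrow> (\<forall>v \<in> lat g - {0}. exp (- r) \<le> supnorm v)"
proof -
  have "column 1 g \<noteq> 0" using g by (auto simp: SL2_iff vec2_eq_iff)
  then have "lat g - {0} \<noteq> {}" using column_in_lat[of 1 g] by auto
  then show ?thesis unfolding Delta_def
    by (subst cSUP_le_iff[OF _ Delta_bdd_above[OF g]]) (auto simp: ln_inverse_supnorm_le_iff)
qed

text \<open>Expressing lattice vectors by integer coefficients turns the condition into a countable
  intersection of closed conditions on the entries of \<open>g\<close>.\<close>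

lemma Delta_le_borel: "{g \<in> SL2. Delta (lat g) \<le> r} \<in> sets borel"
proof -
  have "{g \<in> SL2. Delta (lat g) \<le> r} = {g \<in> space borel. g \<in> SL2 \<and> (\<forall>m n :: int. (m \<noteq> 0 \<or> n \<noteq> 0) \<longrightarrow>
    exp (- r) \<le> max \<bar>of_int m * g$1$1 + of_int n * g$1$2\<bar> \<bar>of_int m * g$2$1 + of_int n * g$2$2\<bar>)}"
  proof -
    have "(\<forall>v \<in> lat g - {0}. exp (- r) \<le> supnorm v) \<longleftrightarrow> (\<forall>m n :: int. (m \<noteq> 0 \<or> n \<noteq> 0) \<longrightarrow>
      exp (- r) \<le> max \<bar>of_int m * g$1$1 + of_int n * g$1$2\<bar> \<bar>of_int m * g$2$1 + of_int n * g$2$2\<bar>)"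
      (is "?l = ?r") if g: "g \<in> SL2" for g
    proof
      assume l: ?l
      show ?r
      proof (intro allI impI)
        fix m n :: int assume nz: "m \<noteq> 0 \<or> n \<noteq> 0"
        define v :: "real^2" where "v = vector [of_int m * g$1$1 + of_int n * g$1$2, of_int m * g$2$1 + of_int n * g$2$2]"
        have v: "v$1 = of_int m * g$1$1 + of_int n * g$1$2" "v$2 = of_int m * g$2$1 + of_int n * g$2$2"
          by (simp_all add: v_def vector_2)
        obtain A where A: "\<And>i j. \<bar>g$i$j\<bar> \<le> A" using entries_bounded[of g] by auto
        have "v \<noteq> 0"
        proof
          assume "v = 0"
          then have "supnorm v \<le> 0" by (simp add: supnorm_def)
          from SL2_coeff_bound[OF g v this A] nz show False by simp
        qed
        moreover have "v \<in> lat g" unfolding lat_iff using v by blast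
        ultimately have "exp (- r) \<le> supnorm v" using l by auto
        then show "exp (- r) \<le> max \<bar>of_int m * g$1$1 + of_int n * g$1$2\<bar> \<bar>of_int m * g$2$1 + of_int n * g$2$2\<bar>"
          by (simp add: supnorm_def v)
      qed
    next
      assume r: ?r
      show ?l
      proof
        fix v assume v: "v \<in> lat g - {0}"
        then obtain m n :: int where mn: "v$1 = of_int m * g$1$1 + of_int n * g$1$2"
          "v$2 = of_int m * g$2$1 + of_int n * g$2$2" by (auto simp: lat_iff)
        have "m \<noteq> 0 \<or> n \<noteq> 0" using v mn by (auto simp: vec2_eq_iff)
        then show "exp (- r) \<le> supnorm v" using r by (simp add: supnorm_def mn)
      qed
    qed
    then show ?thesis by (auto simp: Delta_le_iff)
  qed
  also have "\<dots> \<in> sets borel" by measurable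
  finally show ?thesis .
qed

text \<open>The lowest vector of the strip has first coordinate below exp (- r), so in
  \<open>K r\<close> its height must reach exp (- r). Conversely, the empty box below a lowest
  vector of that height contains the open square.\<close>

lemma K_iff_lowest_bases:
  assumes g: "g \<in> SL2" and L: "horizontal_free (lat g)"
  shows "lat g \<in> K r \<longleftrightarrow> (\<exists>h \<in> lowest_bases (exp (- r)) (exp (- r)). lat h = lat g)"
proof
  assume "lat g \<in> K r"
  then have "Delta (lat g) \<le> r" by (simp add: K_def)
  then have far: "\<forall>v \<in> lat g - {0}. exp (- r) \<le> supnorm v" by (simp add: Delta_le_iff[OF g])
  obtain h where h: "h \<in> lowest_bases (exp (- r)) 0" "lat h = lat g"
    using lowest_basis_exists[OF g L, of "exp (- r)"] by auto
  have "column 1 h \<in> lat g - {0}" using h column_in_lat[of 1 h] by (auto simp: lowest_bases_def vec2_eq_iff)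
  then have "exp (- r) \<le> supnorm (column 1 h)" using far by blast
  then have "h \<in> lowest_bases (exp (- r)) (exp (- r))" using h by (auto simp: lowest_bases_def supnorm_def)
  then show "\<exists>h \<in> lowest_bases (exp (- r)) (exp (- r)). lat h = lat g" using h by blast
next
  assume "\<exists>h \<in> lowest_bases (exp (- r)) (exp (- r)). lat h = lat g"
  then obtain h where h: "h \<in> lowest_bases (exp (- r)) (exp (- r))" "lat h = lat g" by auto
  have "exp (- r) \<le> supnorm v" if v: "v \<in> lat g - {0}" for v
  proof -
    have "\<not> (\<bar>v$1\<bar> < exp (- r) \<and> \<bar>v$2\<bar> < h$2$1)"
      using lowest_bases_empty_box[OF h(1), of v] v h(2) by auto
    moreover have "exp (- r) \<le> h$2$1" using h by (simp add: lowest_bases_def)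
    ultimately show ?thesis by (auto simp: supnorm_def)
  qed
  then have "Delta (lat g) \<le> r" by (simp add: Delta_le_iff[OF g])
  \<comment> \<open>In the strip of half width 1 the height bound gives a lowest vector of supremum
    norm at most 1.\<close>
  moreover have "0 \<le> Delta (lat g)"
  proof -
    obtain k where k: "k \<in> lowest_bases 1 0" "lat k = lat g" using lowest_basis_exists[OF g L, of 1] by auto
    have c: "column 1 k \<noteq> 0" using k by (auto simp: lowest_bases_def vec2_eq_iff)
    then have v: "column 1 k \<in> lat g - {0}" using k column_in_lat[of 1 k] by auto
    have "supnorm (column 1 k) \<le> 1"
      using k lowest_bases_height[OF k(1)] by (auto simp: supnorm_def lowest_bases_def)
    then have "0 \<le> ln (1 / supnorm (column 1 k))" using supnorm_pos[OF c] by (simp add: ln_div)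
    then show ?thesis unfolding Delta_def by (rule cSUP_upper2[OF Delta_bdd_above[OF g] v])
  qed
  ultimately show "lat g \<in> K r" using g by (auto simp: K_def unimod_lattices_def)
qed

lemma basis_count_lowest_bases:
  assumes L: "horizontal_free L"
  shows "basis_count (lowest_bases s b) L = indicator {L. \<exists>h \<in> lowest_bases s b. lat h = L} L"
proof (cases "\<exists>h \<in> lowest_bases s b. lat h = L")
  case True
  then obtain h where h: "h \<in> lowest_bases s b" "lat h = L" by auto
  then have hb: "h \<in> bases L" by (auto simp: bases_def lowest_bases_def)
  have "basis_count (lowest_bases s b) L = (\<integral>\<^sup>+g. indicator {h} g \<partial>count_space (bases L))"
    unfolding basis_count_def
  proof (rule nn_integral_cong)
    fix g assume "g \<in> space (count_space (bases L))"
    then have g: "lat g = L" by (simp add: bases_def)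
    have "g = h" if "g \<in> lowest_bases s b"
      by (rule lowest_bases_unique[OF that h(1)]) (simp_all add: g h(2) L)
    then have "g \<in> lowest_bases s b \<longleftrightarrow> g \<in> {h}" using h(1) by blast
    then show "indicator (lowest_bases s b) g = (indicator {h} g :: ennreal)"
      by (simp only: indicator_def)
  qed
  also have "\<dots> = emeasure (count_space (bases L)) {h}" by (rule nn_integral_indicator) (simp add: hb)
  also have "\<dots> = 1" by (subst emeasure_count_space_finite) (simp_all add: hb)
  finally show ?thesis using True by simp
next
  case False
  then have "basis_count (lowest_bases s b) L = (\<integral>\<^sup>+g. 0 \<partial>count_space (bases L))"
    unfolding basis_count_def by (intro nn_integral_cong) (auto simp: indicator_def bases_def)
  then show ?thesis using False by simp
qed

lemma haar_lowest_bases_1: "haar (indicator (lowest_bases 1 0)) = ennreal (pi\<^sup>2 / 6)"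
proof -
  have "haar (indicator (lowest_bases 1 0)) = 2 * ennreal (pi\<^sup>2 / 12)"
    using haar_lowest_bases[of 1 0] nn_integral_inverse_one_plus by simp
  also have "\<dots> = ennreal 2 * ennreal (pi\<^sup>2 / 12)" by simp
  also have "\<dots> = ennreal (pi\<^sup>2 / 6)" by (subst ennreal_mult[symmetric]) auto
  finally show ?thesis .
qed

section \<open>From Haar measure to the measure of \<open>K r\<close>\<close>

context
  fixes M assumes inv: "invariant_prob M"
begin

lemma K_measurable: "K r \<in> sets M"
proof -
  define k where "k g = (if g \<in> SL2 then Delta (lat g) else 0)" for g
  have "k \<in> borel_measurable borel"
  proof (subst borel_measurable_iff_le, intro allI)
    fix a
    have "{g \<in> space borel. k g \<le> a} = {g \<in> SL2. Delta (lat g) \<le> a} \<union> (if 0 \<le> a then - SL2 else {})"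
      by (auto simp: k_def)
    then show "{g \<in> space borel. k g \<le> a} \<in> sets borel" using Delta_le_borel[of a] by (auto simp: borel_comp)
  qed
  then have "Delta \<in> borel_measurable M" by (rule measurable_lattice[OF inv]) (simp add: k_def)
  then have "Delta -` {0..r} \<inter> space M \<in> sets M" by (rule measurable_sets) simp
  moreover have "Delta -` {0..r} \<inter> space M = K r" by (auto simp: K_def invariant_prob_facts[OF inv])
  ultimately show ?thesis by simp
qed

text \<open>Proportionality in cross-multiplied form, valid even where values are 0 or
  infinite.\<close>

lemma basis_measure_haar:
  assumes [measurable]: "A \<in> sets borel" "B \<in> sets borel"
  shows "emeasure (basis_measure M) A * haar (indicator B) = emeasure (basis_measure M) B * haar (indicator A)"
  using haar_unique[OF sets_basis_measure sigma_finite_basis_measure[OF inv] AE_basis_measure_SL2[OF inv]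
      basis_measure_left_invariant[OF inv], of "indicator A" "indicator B"] by simp

text \<open>A lattice with a horizontal vector has a basis with lower left entry 0. Such matrices
  have Haar measure 0, and comparison with a set of positive Haar measure makes them null for the
  lift.\<close>

lemma AE_horizontal_free: "AE L in M. horizontal_free L"
proof -
  define N where "N = {g :: real^2^2. g$2$1 = 0}"
  have "{g \<in> space borel. (g :: real^2^2)$2$1 = 0} \<in> sets borel" by measurable
  then have N: "N \<in> sets borel" by (simp add: N_def)
  have "ennreal (1 / \<bar>y\<bar>) * indicator N (haar_mat x y q) = 0" for x y q
    by (simp add: N_def haar_mat_def indicator_def)
  then have "haar (indicator N) = 0" unfolding haar_def by (simp only:) simp
  then have "emeasure (basis_measure M) N * ennreal (pi\<^sup>2 / 6) = 0"
    using basis_measure_haar[OF N lowest_bases_borel, of 1 0] by (simp add: haar_lowest_bases_1)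
  then have "(\<integral>\<^sup>+L. basis_count N L \<partial>M) = 0"
    using emeasure_basis_measure[OF inv N] by (simp add: ennreal_eq_0_iff not_le)
  then have "AE L in M. basis_count N L = 0"
    using basis_count_measurable[OF inv N] by (simp add: nn_integral_0_iff_AE)
  moreover have "horizontal_free L" if "L \<in> space M" and 0: "basis_count N L = 0" for L
  proof (rule ccontr)
    assume "\<not> horizontal_free L"
    then obtain h where h: "h \<in> bases L" "h \<in> N"
      using horizontal_basis \<open>L \<in> space M\<close> by (auto simp: invariant_prob_facts[OF inv] unimod_lattices_def N_def)
    have "AE g in count_space (bases L). indicator N g = (0::ennreal)"
      using 0 unfolding basis_count_def by (simp add: nn_integral_0_iff_AE)
    then show False using h by (auto simp: AE_count_space)
  qed
  ultimately show ?thesis by (auto elim!: AE_mp)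
qed

lemma basis_measure_lowest_bases_1: "emeasure (basis_measure M) (lowest_bases 1 0) = 1"
proof -
  interpret prob_space M by (rule invariant_prob_facts[OF inv])
  have "emeasure (basis_measure M) (lowest_bases 1 0) = (\<integral>\<^sup>+L. basis_count (lowest_bases 1 0) L \<partial>M)"
    by (simp add: emeasure_basis_measure[OF inv])
  also have "\<dots> = (\<integral>\<^sup>+L. 1 \<partial>M)"
  proof (rule nn_integral_cong_AE, rule AE_mp[OF AE_horizontal_free], intro AE_I2 impI)
    fix L assume "L \<in> space M" "horizontal_free L"
    then show "basis_count (lowest_bases 1 0) L = 1"
      using lowest_basis_exists[of _ 1] by (auto simp: basis_count_lowest_bases invariant_prob_facts[OF inv] unimod_lattices_def)
  qed
  finally show ?thesis by (simp add: emeasure_space_1)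
qed

lemma basis_measure_lowest_bases_K:
  "emeasure (basis_measure M) (lowest_bases (exp (- r)) (exp (- r))) = emeasure M (K r)"
proof -
  have "emeasure (basis_measure M) (lowest_bases (exp (- r)) (exp (- r)))
    = (\<integral>\<^sup>+L. basis_count (lowest_bases (exp (- r)) (exp (- r))) L \<partial>M)"
    by (simp add: emeasure_basis_measure[OF inv])
  also have "\<dots> = (\<integral>\<^sup>+L. indicator (K r) L \<partial>M)"
  proof (rule nn_integral_cong_AE, rule AE_mp[OF AE_horizontal_free], intro AE_I2 impI)
    fix L assume "L \<in> space M" "horizontal_free L"
    then show "basis_count (lowest_bases (exp (- r)) (exp (- r))) L = indicator (K r) L"
      using K_iff_lowest_bases by (auto simp: basis_count_lowest_bases invariant_prob_facts[OF inv] unimod_lattices_def indicator_def)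
  qed
  finally show ?thesis using K_measurable by simp
qed

text \<open>With exp (- 2 r) = 1 / (1 + \<epsilon>), the integrand is (\<epsilon> - u) / ((1 + u) (1
  + \<epsilon>)) for u = x t. Where it is positive the denominator lies between 1 and (1 +
  \<epsilon>)^2, and \<open>W\<close> is twice the hyperbola integral.\<close>

lemma measure_K_bounds:
  assumes r: "0 < r" "r < ln 2 / 2"
  defines "\<epsilon> \<equiv> exp (2 * r) - 1"
  defines "W \<equiv> 3/2 * \<epsilon>\<^sup>2 + \<epsilon>\<^sup>2 * ln (1 / \<epsilon>)"
  shows "measure M (K r) * (pi\<^sup>2 / 6) \<le> W" "W / (1 + \<epsilon>)\<^sup>2 \<le> measure M (K r) * (pi\<^sup>2 / 6)"
proof -
  interpret prob_space M by (rule invariant_prob_facts[OF inv])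
  have e0: "0 < \<epsilon>" using r by (simp add: \<epsilon>_def)
  \<comment> \<open>The bound on r says precisely that \<epsilon> < 1, the range of
    \<open>nn_integral_hyperbola\<close>.\<close>
  have "exp (2 * r) < exp (ln 2)" using r by (subst exp_less_cancel_iff) simp
  then have e1: "\<epsilon> < 1" by (simp add: \<epsilon>_def)
  have W0: "0 \<le> W" using e0 e1 by (simp add: W_def)
  have ss: "exp (- r) * exp (- r) = 1 / (1 + \<epsilon>)"
    by (simp add: \<epsilon>_def exp_minus mult_exp_exp field_simps)
  define Q where "Q = (\<integral>\<^sup>+t. \<integral>\<^sup>+x. indicator {0..1} t * (indicator {0..1} x * ennreal (1 / (1 + x * t) - 1 / (1 + \<epsilon>))) \<partial>lborel \<partial>lborel)"
  define R where "R = (\<integral>\<^sup>+t. \<integral>\<^sup>+x. indicator {0..1} t * (indicator {0..1} x * ennreal (\<epsilon> - x * t)) \<partial>lborel \<partial>lborel)"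
  have "ennreal (measure M (K r) * (pi\<^sup>2 / 6)) = emeasure M (K r) * ennreal (pi\<^sup>2 / 6)"
    unfolding emeasure_eq_measure by (rule ennreal_mult) auto
  also have "\<dots> = haar (indicator (lowest_bases (exp (- r)) (exp (- r))))"
    using basis_measure_haar[OF lowest_bases_borel lowest_bases_borel, of "exp (- r)" "exp (- r)" 1 0]
    by (simp add: basis_measure_lowest_bases_K basis_measure_lowest_bases_1 haar_lowest_bases_1)
  also have "\<dots> = 2 * Q" by (subst haar_lowest_bases) (auto simp: ss Q_def)
  finally have PQ: "ennreal (measure M (K r) * (pi\<^sup>2 / 6)) = 2 * Q" .
  have "R = ennreal (W / 2)" using nn_integral_hyperbola[OF e0 e1] by (simp add: R_def W_def field_simps)
  then have "2 * R = ennreal 2 * ennreal (W / 2)" by simp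
  also have "\<dots> = ennreal W" using W0 by (subst ennreal_mult[symmetric]) auto
  finally have RW: "2 * R = ennreal W" .
  have frac: "1 / (1 + u) - 1 / (1 + \<epsilon>) = (\<epsilon> - u) / ((1 + u) * (1 + \<epsilon>))" if "0 \<le> u" for u
    using that e0 by (simp add: field_simps)
  have up: "ennreal (1 / (1 + u) - 1 / (1 + \<epsilon>)) \<le> ennreal (\<epsilon> - u)" if u: "0 \<le> u" for u
  proof (cases "u \<le> \<epsilon>")
    case True
    have "1 * 1 \<le> (1 + u) * (1 + \<epsilon>)" using u e0 by (intro mult_mono) auto
    then have "(\<epsilon> - u) / ((1 + u) * (1 + \<epsilon>)) \<le> (\<epsilon> - u) / 1" using True by (intro divide_left_mono) auto
    then show ?thesis unfolding frac[OF u] by (intro ennreal_leI) simp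
  next
    case False
    then have "(\<epsilon> - u) / ((1 + u) * (1 + \<epsilon>)) \<le> 0" using u e0 by (intro divide_nonpos_nonneg) auto
    then show ?thesis unfolding frac[OF u] by (simp add: ennreal_neg)
  qed
  have low: "ennreal (1 / (1 + \<epsilon>)\<^sup>2) * ennreal (\<epsilon> - u) \<le> ennreal (1 / (1 + u) - 1 / (1 + \<epsilon>))" if u: "0 \<le> u" for u
  proof (cases "u \<le> \<epsilon>")
    case True
    have "(1 + u) * (1 + \<epsilon>) \<le> (1 + \<epsilon>)\<^sup>2" unfolding power2_eq_square using True e0 by (intro mult_right_mono) auto
    moreover have "0 < (1 + u) * (1 + \<epsilon>)" using u e0 by simp
    ultimately have "(\<epsilon> - u) / (1 + \<epsilon>)\<^sup>2 \<le> (\<epsilon> - u) / ((1 + u) * (1 + \<epsilon>))"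
      using True e0 u by (intro divide_left_mono mult_pos_pos) auto
    moreover have "ennreal (1 / (1 + \<epsilon>)\<^sup>2) * ennreal (\<epsilon> - u) = ennreal ((\<epsilon> - u) / (1 + \<epsilon>)\<^sup>2)"
      using True by (subst ennreal_mult[symmetric]) auto
    ultimately show ?thesis unfolding frac[OF u] by (simp add: ennreal_leI)
  next
    case False
    then show ?thesis by (simp add: ennreal_neg)
  qed
  have "Q \<le> R" unfolding Q_def R_def
  proof (intro nn_integral_mono)
    fix t x :: real
    show "indicator {0..1} t * (indicator {0..1} x * ennreal (1 / (1 + x * t) - 1 / (1 + \<epsilon>)))
      \<le> indicator {0..1} t * (indicator {0..1} x * ennreal (\<epsilon> - x * t))"
      using up[of "x * t"] by (auto simp: indicator_def)
  qed
  then have "2 * Q \<le> 2 * R" by (rule mult_left_mono) simp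
  then have "ennreal (measure M (K r) * (pi\<^sup>2 / 6)) \<le> ennreal W" by (simp only: PQ RW)
  then show "measure M (K r) * (pi\<^sup>2 / 6) \<le> W" using W0 by (simp add: ennreal_le_iff)
  have "ennreal (1 / (1 + \<epsilon>)\<^sup>2) * R
    = (\<integral>\<^sup>+t. \<integral>\<^sup>+x. ennreal (1 / (1 + \<epsilon>)\<^sup>2) * (indicator {0..1} t * (indicator {0..1} x * ennreal (\<epsilon> - x * t))) \<partial>lborel \<partial>lborel)"
    unfolding R_def by (simp add: nn_integral_cmult)
  also have "\<dots> \<le> Q" unfolding Q_def
  proof (intro nn_integral_mono)
    fix t x :: real
    show "ennreal (1 / (1 + \<epsilon>)\<^sup>2) * (indicator {0..1} t * (indicator {0..1} x * ennreal (\<epsilon> - x * t)))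
      \<le> indicator {0..1} t * (indicator {0..1} x * ennreal (1 / (1 + x * t) - 1 / (1 + \<epsilon>)))"
      using low[of "x * t"] by (auto simp: indicator_def)
  qed
  finally have "ennreal (1 / (1 + \<epsilon>)\<^sup>2) * R \<le> Q" .
  then have "2 * (ennreal (1 / (1 + \<epsilon>)\<^sup>2) * R) \<le> 2 * Q" by (rule mult_left_mono) simp
  then have "ennreal (1 / (1 + \<epsilon>)\<^sup>2) * (2 * R) \<le> ennreal (measure M (K r) * (pi\<^sup>2 / 6))"
    by (simp only: PQ mult.left_commute)
  then have "ennreal (W / (1 + \<epsilon>)\<^sup>2) \<le> ennreal (measure M (K r) * (pi\<^sup>2 / 6))"
    unfolding RW using W0 by (simp add: ennreal_mult[symmetric])
  then show "W / (1 + \<epsilon>)\<^sup>2 \<le> measure M (K r) * (pi\<^sup>2 / 6)" by (simp add: ennreal_le_iff)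
qed

end

text \<open>\<epsilon> equals 2 r up to O(r^2), which alters the main term by a multiple of r^3 ln
  (1 / r); since r ln (1 / r) \<le> 1, this is O(r^2).\<close>

lemma squeeze_asymptotics:
  fixes r h :: real
  assumes r: "0 < r" "r < ln 2 / 2"
  defines "\<epsilon> \<equiv> exp (2 * r) - 1"
  defines "W \<equiv> 3/2 * \<epsilon>\<^sup>2 + \<epsilon>\<^sup>2 * ln (1 / \<epsilon>)"
  assumes h: "h \<le> W" "W / (1 + \<epsilon>)\<^sup>2 \<le> h"
  shows "\<bar>h - 4 * r\<^sup>2 * ln (1 / r)\<bar> \<le> 48 * r\<^sup>2"
proof -
  define l where "l = ln (1 / r)"
  define lam where "lam = ln (1 / \<epsilon>)"
  have r2: "r < 1 / 2" using r ln_2_less_1 by simp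
  have "exp (2 * r) < exp (ln 2)" using r by (subst exp_less_cancel_iff) simp
  then have e1: "\<epsilon> < 1" by (simp add: \<epsilon>_def)
  have e2: "2 * r \<le> \<epsilon>" using exp_ge_add_one_self[of "2 * r"] unfolding \<epsilon>_def by linarith
  have e3: "\<epsilon> \<le> 2 * r + 4 * r\<^sup>2" using exp_bound[of "2 * r"] r r2 by (simp add: \<epsilon>_def power_mult_distrib)
  have "r * r \<le> r * (1 / 2)" using r r2 by (intro mult_left_mono) auto
  then have e4: "\<epsilon> \<le> 4 * r" using e3 by (simp add: power2_eq_square)
  have e0: "0 < \<epsilon>" using e2 r by simp
  have rl: "r * l \<le> 1"
  proof -
    have "l \<le> 1 / r" using ln_le_minus_one[of "1 / r"] r by (simp add: l_def)
    then have "r * l \<le> r * (1 / r)" using r by (intro mult_left_mono) auto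
    then show ?thesis using r by simp
  qed
  have el: "\<epsilon> * lam \<le> 1"
  proof -
    have "lam \<le> 1 / \<epsilon>" using ln_le_minus_one[of "1 / \<epsilon>"] e0 by (simp add: lam_def)
    then have "\<epsilon> * lam \<le> \<epsilon> * (1 / \<epsilon>)" using e0 by (intro mult_left_mono) auto
    then show ?thesis using e0 by simp
  qed
  have l0: "0 \<le> l" using r r2 by (simp add: l_def)
  have lam0: "0 \<le> lam" using e0 e1 by (simp add: lam_def)
  have lamup: "lam \<le> l" using e0 e2 r by (simp add: lam_def l_def ln_div)
  \<comment> \<open>From \<epsilon> \<le> 4 r the loss is at most ln 4 = 2 ln 2 < 2.\<close>
  have lamlow: "l - 2 \<le> lam"
  proof -
    have "ln \<epsilon> \<le> ln (4 * r)" using e4 e0 r by (subst ln_le_cancel_iff) auto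
    moreover have "ln (4 * r) = ln 4 + ln r" using r by (simp add: ln_mult)
    moreover have "ln (4::real) = 2 * ln 2" using ln_realpow[of 2 2] by simp
    ultimately show ?thesis using ln_2_less_1 e0 r by (simp add: lam_def l_def ln_div)
  qed
  have sq: "\<epsilon>\<^sup>2 \<le> 16 * r\<^sup>2" using power_mono[OF e4, of 2] e0 by (simp add: power_mult_distrib)
  have "\<epsilon>\<^sup>2 \<le> (2 * r + 4 * r\<^sup>2)\<^sup>2" using power_mono[OF e3, of 2] e0 by simp
  then have "\<epsilon>\<^sup>2 * lam \<le> (2 * r + 4 * r\<^sup>2)\<^sup>2 * l" using lamup lam0 by (intro mult_mono) auto
  also have "\<dots> = 4 * r\<^sup>2 * l + 16 * r\<^sup>2 * (r * l) + 16 * r\<^sup>2 * (r * (r * l))"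
    by (simp add: power2_eq_square algebra_simps)
  also have "\<dots> \<le> 4 * r\<^sup>2 * l + 16 * r\<^sup>2 * 1 + 16 * r\<^sup>2 * (1 / 2 * 1)"
    using rl r r2 l0 by (intro add_mono mult_left_mono mult_mono) auto
  finally have up: "\<epsilon>\<^sup>2 * lam \<le> 4 * r\<^sup>2 * l + 24 * r\<^sup>2" by simp
  \<comment> \<open>The 48 is 24 from \<open>up\<close> plus 3/2 * 16 from the square term of
    \<open>W\<close>.\<close>
  have U: "h \<le> 4 * r\<^sup>2 * l + 48 * r\<^sup>2"
    using h(1) up sq unfolding W_def lam_def[symmetric] by linarith
  \<comment> \<open>Linearised so that the correction is a multiple of r^2 \<epsilon>
    \<open>lam\<close>, which \<open>el\<close> bounds by a multiple of r^2.\<close>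
  have inv: "1 - 2 * \<epsilon> \<le> 1 / (1 + \<epsilon>)\<^sup>2"
  proof -
    have "(1 - 2 * \<epsilon>) * (1 + \<epsilon>)\<^sup>2 = 1 - (3 * \<epsilon>\<^sup>2 + 2 * (\<epsilon> * \<epsilon>\<^sup>2))" by (simp add: power2_eq_square algebra_simps)
    also have "\<dots> \<le> 1"
    proof -
      have "0 \<le> \<epsilon> * \<epsilon>\<^sup>2" "0 \<le> \<epsilon>\<^sup>2" using e0 by auto
      then show ?thesis by linarith
    qed
    finally show ?thesis using e0 by (simp add: pos_le_divide_eq)
  qed
  have "4 * r\<^sup>2 * lam * (1 - 2 * \<epsilon>) \<le> 4 * r\<^sup>2 * lam * (1 / (1 + \<epsilon>)\<^sup>2)"
    using inv lam0 by (intro mult_left_mono) auto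
  also have "\<dots> \<le> W * (1 / (1 + \<epsilon>)\<^sup>2)"
  proof (rule mult_right_mono)
    have "4 * r\<^sup>2 \<le> \<epsilon>\<^sup>2" using power_mono[OF e2, of 2] r by (simp add: power_mult_distrib)
    then have "4 * r\<^sup>2 * lam \<le> \<epsilon>\<^sup>2 * lam" using lam0 by (intro mult_right_mono) auto
    then show "4 * r\<^sup>2 * lam \<le> W" unfolding W_def lam_def[symmetric] using e0 zero_le_power2[of \<epsilon>] by linarith
  qed simp
  also have "\<dots> \<le> h" using h(2) by simp
  finally have "4 * r\<^sup>2 * lam - 8 * r\<^sup>2 * (\<epsilon> * lam) \<le> h" by (simp add: algebra_simps)
  moreover have "8 * r\<^sup>2 * (\<epsilon> * lam) \<le> 8 * r\<^sup>2 * 1" using el by (intro mult_left_mono) auto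
  moreover have "4 * r\<^sup>2 * (l - 2) \<le> 4 * r\<^sup>2 * lam" using lamlow by (intro mult_left_mono) auto
  then have "4 * r\<^sup>2 * l - 8 * r\<^sup>2 \<le> 4 * r\<^sup>2 * lam" by (simp add: algebra_simps)
  ultimately have "4 * r\<^sup>2 * l - 16 * r\<^sup>2 \<le> h" by linarith
  moreover have "0 \<le> r\<^sup>2" by simp
  ultimately show ?thesis using U unfolding l_def[symmetric] by (simp add: abs_le_iff)
qed

theorem theorem1p2:
  shows "\<exists>C::real. \<forall>M r. invariant_prob M \<longrightarrow> 0 < r \<longrightarrow> r < ln 2 / 2 \<longrightarrow>
           \<bar>measure M (K r) - 4 * r^2 * ln (1 / r) / (pi^2 / 6)\<bar> \<le> C * r^2"
proof (intro exI[of _ "48 / (pi\<^sup>2 / 6)"] allI impI)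
  fix M and r :: real
  assume M: "invariant_prob M" and r: "0 < r" "r < ln 2 / 2"
  define z where "z = pi\<^sup>2 / 6"
  have z: "0 < z" by (simp add: z_def)
  have "\<bar>measure M (K r) * z - 4 * r\<^sup>2 * ln (1 / r)\<bar> \<le> 48 * r\<^sup>2"
    unfolding z_def by (rule squeeze_asymptotics[OF r measure_K_bounds[OF M r]])
  then have "\<bar>measure M (K r) * z - 4 * r\<^sup>2 * ln (1 / r)\<bar> / z \<le> 48 * r\<^sup>2 / z"
    using z by (intro divide_right_mono) auto
  moreover have "\<bar>measure M (K r) * z - 4 * r\<^sup>2 * ln (1 / r)\<bar> / z = \<bar>measure M (K r) - 4 * r\<^sup>2 * ln (1 / r) / z\<bar>"
  proof -
    have "measure M (K r) - 4 * r\<^sup>2 * ln (1 / r) / z = (measure M (K r) * z - 4 * r\<^sup>2 * ln (1 / r)) / z"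
      using z by (simp add: field_simps)
    then show ?thesis using z by (simp add: abs_divide)
  qed
  ultimately show "\<bar>measure M (K r) - 4 * r\<^sup>2 * ln (1 / r) / (pi\<^sup>2 / 6)\<bar> \<le> 48 / (pi\<^sup>2 / 6) * r\<^sup>2"
    by (simp add: z_def)
qed

end
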